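(* Let $p$ be a prime integer, and let $A$ be a discrete valuation ring with uniformizer $p$ and perfect residue field, and assume that $A$ has a $p$-derivation. Let $G$ be a finite group of order $D$ coprime with $p$, acting by degree-preserving $A$-algebra automorphisms on $S=A[x_1,\ldots,x_m]$, where $\deg(x_i)=1$ for all $i$. Let $R=S^G$ be the ring of invariants, and let $\mathfrak{m}=R_{>0}+pR$. Then $Q^{(nD)}\subseteq\mathfrak{m}^n$ for every homogeneous prime ideal $Q\subseteq R$ and every integer $n\geq 1$.
   Context: All rings are commutative with identity. Elements of $A$ have degree $0$ in $S$; $R=S^G$ inherits the grading of $S$ and $R_{>0}$ is the ideal of $R$ generated by its homogeneous elements of positive degree. $p$-derivation: if $T$ is a ring in which $p$ is a nonzerodivisor, a map of sets $\delta:T\to T$ is a $p$-derivation if the map $\phi_p:T\to T$, $\phi_p(x)=x^p+p\,\delta(x)$, is a ring homomorphism. Symbolic powers: for a prime ideal $Q$ of $R$, $Q^{(n)}=Q^nR_Q\cap R$. *)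

theory Defs
  imports
    "HOL-Algebra.Algebra"
    "HOL-Algebra.Algebraic_Closure_Type"
    "HOL-Computational_Algebra.Primes"
    "HOL-Library.Poly_Mapping"
begin

section \<open>Discrete valuation rings, perfect fields and \<open>p\<close>-derivations\<close>

text \<open>The image of a natural number \<open>n\<close> in a ring \<open>T\<close> is written \<open>add_pow T n \<one>\<^bsub>T\<^esub>\<close>.\<close>

locale discrete_valuation_ring = principal_domain A for A (structure) +
  assumes not_field: "\<not> field A"
    and unique_maximal: "\<exists>!M. maximalideal M A"

definition uniformizer :: "('a, 'b) ring_scheme \<Rightarrow> 'a \<Rightarrow> bool" where
  "uniformizer A u \<longleftrightarrow> u \<in> carrier A \<and> maximalideal (PIdl\<^bsub>A\<^esub> u) A"

text \<open>The second condition is void in characteristic 0; in characteristic \<open>q > 0\<close> it says that the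
  Frobenius map is surjective.\<close>

definition perfect_field :: "('a, 'b) ring_scheme \<Rightarrow> bool" where
  "perfect_field F \<longleftrightarrow> field F \<and>
     (\<forall>q::nat. Factorial_Ring.prime q \<and> add_pow F q \<one>\<^bsub>F\<^esub> = \<zero>\<^bsub>F\<^esub> \<longrightarrow>
        (\<forall>x\<in>carrier F. \<exists>y\<in>carrier F. y [^]\<^bsub>F\<^esub> q = x))"

definition nonzerodivisor :: "('a, 'b) ring_scheme \<Rightarrow> 'a \<Rightarrow> bool" where
  "nonzerodivisor T a \<longleftrightarrow> a \<in> carrier T \<and>
     (\<forall>x\<in>carrier T. a \<otimes>\<^bsub>T\<^esub> x = \<zero>\<^bsub>T\<^esub> \<longrightarrow> x = \<zero>\<^bsub>T\<^esub>)"

definition p_derivation :: "('a, 'b) ring_scheme \<Rightarrow> nat \<Rightarrow> ('a \<Rightarrow> 'a) \<Rightarrow> bool" where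
  "p_derivation T p \<delta> \<longleftrightarrow> nonzerodivisor T (add_pow T p \<one>\<^bsub>T\<^esub>) \<and> \<delta> \<in> carrier T \<rightarrow> carrier T \<and>
     (\<lambda>x. x [^]\<^bsub>T\<^esub> p \<oplus>\<^bsub>T\<^esub> add_pow T p \<one>\<^bsub>T\<^esub> \<otimes>\<^bsub>T\<^esub> \<delta> x) \<in> ring_hom T T"


section \<open>Localization at a prime ideal and symbolic powers\<close>

text \<open>The class of the fraction \<open>r/s\<close>, and the ring \<open>R\<^sub>Q\<close> of such classes with \<open>s \<notin> Q\<close>. Operations on
  classes are unions over representatives, as for quotient rings in the library.\<close>

definition fraction :: "('a, 'b) ring_scheme \<Rightarrow> 'a set \<Rightarrow> 'a \<Rightarrow> 'a \<Rightarrow> ('a \<times> 'a) set" where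
  "fraction R Q r s = {(a, b). a \<in> carrier R \<and> b \<in> carrier R - Q \<and>
     (\<exists>t\<in>carrier R - Q. t \<otimes>\<^bsub>R\<^esub> (r \<otimes>\<^bsub>R\<^esub> b \<ominus>\<^bsub>R\<^esub> a \<otimes>\<^bsub>R\<^esub> s) = \<zero>\<^bsub>R\<^esub>)}"

definition localization :: "('a, 'b) ring_scheme \<Rightarrow> 'a set \<Rightarrow> ('a \<times> 'a) set ring" where
  "localization R Q = \<lparr>
     carrier = {fraction R Q r s | r s. r \<in> carrier R \<and> s \<in> carrier R - Q},
     monoid.mult = (\<lambda>U V. \<Union>(a, s)\<in>U. \<Union>(b, t)\<in>V. fraction R Q (a \<otimes>\<^bsub>R\<^esub> b) (s \<otimes>\<^bsub>R\<^esub> t)),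
     one = fraction R Q \<one>\<^bsub>R\<^esub> \<one>\<^bsub>R\<^esub>,
     ring.zero = fraction R Q \<zero>\<^bsub>R\<^esub> \<one>\<^bsub>R\<^esub>,
     add = (\<lambda>U V. \<Union>(a, s)\<in>U. \<Union>(b, t)\<in>V.
       fraction R Q (a \<otimes>\<^bsub>R\<^esub> t \<oplus>\<^bsub>R\<^esub> b \<otimes>\<^bsub>R\<^esub> s) (s \<otimes>\<^bsub>R\<^esub> t))\<rparr>"

text \<open>The power \<open>I\<^sup>n\<close> of an ideal is taken in the monoid of ideals \<^const>\<open>ideals_set\<close>.\<close>

definition ideal_power :: "('a, 'b) ring_scheme \<Rightarrow> 'a set \<Rightarrow> nat \<Rightarrow> 'a set" where
  "ideal_power R I n = I [^]\<^bsub>ideals_set R\<^esub> n"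

text \<open>\<open>Q\<^sup>n R\<^sub>Q \<inter> R\<close>, where the intersection is the preimage under \<open>r \<mapsto> r/1\<close>.\<close>

definition symbolic_power :: "('a, 'b) ring_scheme \<Rightarrow> 'a set \<Rightarrow> nat \<Rightarrow> 'a set" where
  "symbolic_power R Q n = {r \<in> carrier R. fraction R Q r \<one>\<^bsub>R\<^esub> \<in>
     Idl\<^bsub>localization R Q\<^esub> ((\<lambda>x. fraction R Q x \<one>\<^bsub>R\<^esub>) ` ideal_power R Q n)}"


section \<open>Polynomial rings and rings of invariants\<close>

text \<open>A polynomial maps monomials to coefficients, and a monomial \<^typ>\<open>nat \<Rightarrow>\<^sub>0 nat\<close> maps indices of
  variables to exponents. The \<open>m\<close> variables are indexed by \<open>0, \<dots>, m - 1\<close>.\<close>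

type_synonym 'a mpoly = "(nat \<Rightarrow>\<^sub>0 nat) \<Rightarrow>\<^sub>0 'a"

definition poly_ring :: "nat \<Rightarrow> 'a::comm_ring_1 mpoly ring" where
  "poly_ring m = ring_of_type_algebra\<lparr>carrier :=
     {f. \<forall>t\<in>Poly_Mapping.keys f. Poly_Mapping.keys t \<subseteq> {..<m}}\<rparr>"

definition const_poly :: "'a::comm_ring_1 \<Rightarrow> 'a mpoly" where
  "const_poly a = Poly_Mapping.single 0 a"

definition monom_deg :: "(nat \<Rightarrow>\<^sub>0 nat) \<Rightarrow> nat" where
  "monom_deg t = (\<Sum>i\<in>Poly_Mapping.keys t. Poly_Mapping.lookup t i)"

definition homogeneous :: "nat \<Rightarrow> 'a::comm_ring_1 mpoly \<Rightarrow> bool" where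
  "homogeneous d f \<longleftrightarrow> (\<forall>t\<in>Poly_Mapping.keys f. monom_deg t = d)"

definition homogeneous_ideal :: "('a::comm_ring_1 mpoly, 'b) ring_scheme \<Rightarrow> 'a mpoly set \<Rightarrow> bool" where
  "homogeneous_ideal R I \<longleftrightarrow>
     (\<exists>H \<subseteq> carrier R. (\<forall>h\<in>H. \<exists>d. homogeneous d h) \<and> I = Idl\<^bsub>R\<^esub> H)"

definition positive_part :: "('a::comm_ring_1 mpoly, 'b) ring_scheme \<Rightarrow> 'a mpoly set" where
  "positive_part R = Idl\<^bsub>R\<^esub> {f \<in> carrier R. \<exists>d>0. homogeneous d f}"

text \<open>Bijectivity of each \<open>\<phi> g\<close> on the polynomial ring is part of \<^locale>\<open>group_action\<close>.\<close>

locale graded_algebra_action = group_action G "carrier (poly_ring m)" \<phi>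
  for G (structure) and m :: nat and \<phi> :: "'g \<Rightarrow> 'a::comm_ring_1 mpoly \<Rightarrow> 'a mpoly" +
  assumes ring_hom: "g \<in> carrier G \<Longrightarrow> \<phi> g \<in> ring_hom (poly_ring m) (poly_ring m)"
    and fixes_const: "g \<in> carrier G \<Longrightarrow> \<phi> g (const_poly a) = const_poly a"
    and degree_preserving: "\<lbrakk>g \<in> carrier G; f \<in> carrier (poly_ring m); homogeneous d f\<rbrakk>
           \<Longrightarrow> homogeneous d (\<phi> g f)"

definition invariant_ring ::
    "('g, 'c) monoid_scheme \<Rightarrow> nat \<Rightarrow> ('g \<Rightarrow> 'a::comm_ring_1 mpoly \<Rightarrow> 'a mpoly) \<Rightarrow> 'a mpoly ring" where
  "invariant_ring G m \<phi> =
     (poly_ring m)\<lparr>carrier := {f \<in> carrier (poly_ring m). \<forall>g\<in>carrier G. \<phi> g f = f}\<rparr>"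

end

theory Submission
  imports Defs
begin

text \<open>Write \<open>S = A[x\<^sub>1, \<dots>, x\<^sub>m]\<close>, \<open>D\<close> for the order of \<open>G\<close>, and \<open>\<nn>\<close> for the ideal of \<open>S\<close> generated by \<open>p\<close>
  and the variables. As \<open>D\<close> is prime to \<open>p\<close>, it is a unit of \<open>A\<close>, so averaging over \<open>G\<close> gives the
  Reynolds operator, an \<open>R\<close>-linear retraction \<open>\<beta>\<close> from \<open>S\<close> onto \<open>R\<close>. The inclusion is obtained by passing
  through \<open>\<nn>\<close>: first \<open>Q\<^sup>(\<^sup>N\<^sup>) \<subseteq> \<nn>\<^sup>N\<close> for all \<open>N\<close>, then \<open>\<nn>\<^sup>n\<^sup>D \<inter> R \<subseteq> \<mm>\<^sup>n\<close>. A polynomial with coefficients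
  \<open>c\<^sub>a\<close> lies in \<open>\<nn>\<^sup>N\<close> exactly if \<open>p\<close> to the power \<open>N - |a|\<close> divides \<open>c\<^sub>a\<close> whenever \<open>|a| < N\<close>, and membership
  in \<open>\<nn>\<^sup>N\<close> is used only in this form.

  The first inclusion is of Zariski--Nagata type and is proved with differential operators. Let \<open>J\<^sub>k\<close>
  be the set of all \<open>f\<close> in \<open>S\<close> with \<open>t f \<in> Q\<^sup>k S\<close> for some \<open>t\<close> in \<open>R\<close> outside \<open>Q\<close>; it contains \<open>Q\<^sup>(\<^sup>k\<^sup>)\<close>.
  A Hasse derivative of order \<open>j\<close> maps \<open>J\<^sub>k\<close> into \<open>J\<^sub>k\<^sub>-\<^sub>j\<close>, by the Leibniz rule (\<open>hasse_saturated_power\<close>).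
  A \<open>p\<close>-derivation of \<open>S\<close> maps \<open>J\<^sub>k\<close> into \<open>J\<^sub>k\<^sub>-\<^sub>1\<close> if \<open>p \<in> Q\<close> (\<open>p_derivation_saturated_power\<close>), and one
  exists because a lift of Frobenius on \<open>A\<close> extends to \<open>S\<close> by raising the variables to the power
  \<open>p\<close>. On the other hand \<open>\<beta>\<close> maps \<open>J\<^sub>1\<close> into \<open>Q\<close> and preserves constant terms, and since \<open>Q\<close> is
  homogeneous, the constant terms of its elements form a prime ideal of \<open>A\<close>, which is \<open>(0)\<close> or \<open>(p)\<close>.
  Now let \<open>f \<in> J\<^sub>N\<close> and \<open>|a| < N\<close>. The Hasse derivative of index \<open>a\<close> turns \<open>c\<^sub>a\<close> into the constant
  term of an element of \<open>J\<^sub>N\<^sub>-\<^sub>|\<^sub>a\<^sub>|\<close>. If the prime ideal is \<open>(0)\<close>, then \<open>c\<^sub>a = 0\<close>. If it is \<open>(p)\<close>, then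
  each application of the \<open>p\<close>-derivation lowers the \<open>p\<close>-adic valuation of the constant term by
  exactly one, so a valuation below \<open>N - |a|\<close> would lead to an element of \<open>J\<^sub>1\<close> whose constant term is
  not divisible by \<open>p\<close> (\<open>saturated_power_coeff_divisible\<close>).

  The second inclusion rests on the bound of Noether in the form of Fleischmann, Fogarty and Benson:
  a product of \<open>D\<close> variables lies in \<open>R\<^sub>>\<^sub>0 S\<close> (\<open>prod_eq_sum_transfers\<close>, \<open>noether_bound\<close>). Hence each
  term of an element of \<open>\<nn>\<^sup>n\<^sup>D\<close> lies in \<open>\<mm>\<^sup>n S\<close>, and \<open>\<beta>\<close> maps \<open>\<mm>\<^sup>n S\<close> into \<open>\<mm>\<^sup>n\<close>.\<close>

section \<open>Localization at a prime ideal\<close>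

locale prime_localization = primeideal Q R for Q and R (structure)
begin

abbreviation "Frac \<equiv> fraction R Q"
abbreviation "denominators \<equiv> carrier R - Q"
abbreviation "L \<equiv> localization R Q"

lemma denominators_mult: "s \<in> denominators \<Longrightarrow> t \<in> denominators \<Longrightarrow> s \<otimes> t \<in> denominators"
  using I_prime by blast

lemma one_denominator: "\<one> \<in> denominators"
  using I_notcarr one_imp_carrier by blast

lemma mem_fraction_iff:
  assumes "r \<in> carrier R" "s \<in> carrier R"
  shows "(a, b) \<in> Frac r s \<longleftrightarrow> a \<in> carrier R \<and> b \<in> denominators \<and>
    (\<exists>t\<in>denominators. t \<otimes> (r \<otimes> b) = t \<otimes> (a \<otimes> s))"
proof -
  have "t \<otimes> (r \<otimes> b \<ominus> a \<otimes> s) = \<zero> \<longleftrightarrow> t \<otimes> (r \<otimes> b) = t \<otimes> (a \<otimes> s)"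
    if "t \<in> carrier R" "a \<in> carrier R" "b \<in> carrier R" for t
  proof -
    have "t \<otimes> (r \<otimes> b \<ominus> a \<otimes> s) = t \<otimes> (r \<otimes> b) \<ominus> t \<otimes> (a \<otimes> s)"
      using assms that by (simp add: a_minus_def r_distr r_minus)
    then show ?thesis
      using assms that by (simp add: r_right_minus_eq)
  qed
  then show ?thesis
    unfolding fraction_def by blast
qed

lemma fraction_eq_iff:
  assumes "r \<in> carrier R" "s \<in> denominators" "r' \<in> carrier R" "s' \<in> denominators"
  shows "Frac r s = Frac r' s' \<longleftrightarrow> (\<exists>t\<in>denominators. t \<otimes> (r \<otimes> s') = t \<otimes> (r' \<otimes> s))"
proof
  assume "Frac r s = Frac r' s'"
  moreover have "(r, s) \<in> Frac r s"
    using assms one_denominator by (auto simp: mem_fraction_iff)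
  ultimately have "(r, s) \<in> Frac r' s'"
    by simp
  then obtain t where "t \<in> denominators" "t \<otimes> (r' \<otimes> s) = t \<otimes> (r \<otimes> s')"
    using assms mem_fraction_iff[of r' s' r s] by auto
  then show "\<exists>t\<in>denominators. t \<otimes> (r \<otimes> s') = t \<otimes> (r' \<otimes> s)"
    by (metis)
next
  have sub: "Frac r s \<subseteq> Frac r' s'"
    if t: "t \<in> denominators" and eq: "t \<otimes> (r \<otimes> s') = t \<otimes> (r' \<otimes> s)"
      and c: "r \<in> carrier R" "s \<in> denominators" "r' \<in> carrier R" "s' \<in> denominators"
    for t r s r' s'
  proof clarify
    fix a b assume "(a, b) \<in> Frac r s"
    then obtain u where ab: "a \<in> carrier R" "b \<in> denominators" and u: "u \<in> denominators"
      and ueq: "u \<otimes> (r \<otimes> b) = u \<otimes> (a \<otimes> s)"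
      using c mem_fraction_iff[of r s a b] by auto
    note cs = t u ab c
    have "(s \<otimes> t \<otimes> u) \<otimes> (r' \<otimes> b) = (u \<otimes> b) \<otimes> (t \<otimes> (r' \<otimes> s))"
      using cs by (simp add: m_ac)
    also have "\<dots> = (u \<otimes> b) \<otimes> (t \<otimes> (r \<otimes> s'))"
      using eq by simp
    also have "\<dots> = (t \<otimes> s') \<otimes> (u \<otimes> (r \<otimes> b))"
      using cs by (simp add: m_ac)
    also have "\<dots> = (t \<otimes> s') \<otimes> (u \<otimes> (a \<otimes> s))"
      using ueq by simp
    also have "\<dots> = (s \<otimes> t \<otimes> u) \<otimes> (a \<otimes> s')"
      using cs by (simp add: m_ac)
    finally show "(a, b) \<in> Frac r' s'"
      using cs denominators_mult by (subst mem_fraction_iff) blast+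
  qed
  assume "\<exists>t\<in>denominators. t \<otimes> (r \<otimes> s') = t \<otimes> (r' \<otimes> s)"
  then show "Frac r s = Frac r' s'"
    using sub assms by (metis subset_antisym)
qed

lemma fraction_eqI:
  assumes "r \<in> carrier R" "s \<in> denominators" "r' \<in> carrier R" "s' \<in> denominators"
    and "r \<otimes> s' = r' \<otimes> s"
  shows "Frac r s = Frac r' s'"
  using fraction_eq_iff[OF assms(1-4)] assms(5) one_denominator by auto

lemma fractionE:
  assumes "(a, b) \<in> Frac r s" "r \<in> carrier R" "s \<in> denominators"
  obtains t where "a \<in> carrier R" "b \<in> denominators" "t \<in> denominators"
    "t \<otimes> (r \<otimes> b) = t \<otimes> (a \<otimes> s)"
  using assms mem_fraction_iff[of r s a b] by auto

lemma fraction_self: "r \<in> carrier R \<Longrightarrow> s \<in> denominators \<Longrightarrow> (r, s) \<in> Frac r s"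
  using one_denominator by (auto simp: mem_fraction_iff)

text \<open>The unions that define the operations on classes run over fractions that are all equal, so that they
  are determined by any one pair of representatives.\<close>

lemma mult_fraction:
  assumes "r \<in> carrier R" "s \<in> denominators" "r' \<in> carrier R" "s' \<in> denominators"
  shows "Frac r s \<otimes>\<^bsub>L\<^esub> Frac r' s' = Frac (r \<otimes> r') (s \<otimes> s')"
proof -
  have "Frac (a \<otimes> b) (c \<otimes> d) = Frac (r \<otimes> r') (s \<otimes> s')"
    if ac: "(a, c) \<in> Frac r s" and bd: "(b, d) \<in> Frac r' s'" for a b c d
  proof -
    obtain t where t: "a \<in> carrier R" "c \<in> denominators" "t \<in> denominators"
      and t_eq: "t \<otimes> (r \<otimes> c) = t \<otimes> (a \<otimes> s)"
      using ac assms(1,2) by (rule fractionE)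
    obtain u where u: "b \<in> carrier R" "d \<in> denominators" "u \<in> denominators"
      and u_eq: "u \<otimes> (r' \<otimes> d) = u \<otimes> (b \<otimes> s')"
      using bd assms(3,4) by (rule fractionE)
    have "(t \<otimes> u) \<otimes> ((a \<otimes> b) \<otimes> (s \<otimes> s')) = (t \<otimes> (a \<otimes> s)) \<otimes> (u \<otimes> (b \<otimes> s'))"
      using assms t u by (simp add: m_ac)
    also have "\<dots> = (t \<otimes> (r \<otimes> c)) \<otimes> (u \<otimes> (r' \<otimes> d))"
      using t_eq u_eq by simp
    also have "\<dots> = (t \<otimes> u) \<otimes> ((r \<otimes> r') \<otimes> (c \<otimes> d))"
      using assms t u by (simp add: m_ac)
    finally have "\<exists>v\<in>denominators. v \<otimes> ((a \<otimes> b) \<otimes> (s \<otimes> s')) = v \<otimes> ((r \<otimes> r') \<otimes> (c \<otimes> d))"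
      using t u denominators_mult by blast
    then show ?thesis
      using assms t u denominators_mult by (subst fraction_eq_iff) auto
  qed
  then have "(\<Union>(a, c)\<in>Frac r s. \<Union>(b, d)\<in>Frac r' s'. Frac (a \<otimes> b) (c \<otimes> d))
      = (\<Union>(a, c)\<in>Frac r s. \<Union>(b, d)\<in>Frac r' s'. Frac (r \<otimes> r') (s \<otimes> s'))"
    by fast
  also have "\<dots> = Frac (r \<otimes> r') (s \<otimes> s')"
    using fraction_self[OF assms(1,2)] fraction_self[OF assms(3,4)] by auto
  finally show ?thesis
    unfolding localization_def by simp
qed

lemma add_fraction:
  assumes "r \<in> carrier R" "s \<in> denominators" "r' \<in> carrier R" "s' \<in> denominators"
  shows "Frac r s \<oplus>\<^bsub>L\<^esub> Frac r' s' = Frac (r \<otimes> s' \<oplus> r' \<otimes> s) (s \<otimes> s')"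
proof -
  have "Frac (a \<otimes> d \<oplus> b \<otimes> c) (c \<otimes> d) = Frac (r \<otimes> s' \<oplus> r' \<otimes> s) (s \<otimes> s')"
    if ac: "(a, c) \<in> Frac r s" and bd: "(b, d) \<in> Frac r' s'" for a b c d
  proof -
    obtain t where t: "a \<in> carrier R" "c \<in> denominators" "t \<in> denominators"
      and t_eq: "t \<otimes> (r \<otimes> c) = t \<otimes> (a \<otimes> s)"
      using ac assms(1,2) by (rule fractionE)
    obtain u where u: "b \<in> carrier R" "d \<in> denominators" "u \<in> denominators"
      and u_eq: "u \<otimes> (r' \<otimes> d) = u \<otimes> (b \<otimes> s')"
      using bd assms(3,4) by (rule fractionE)
    have "(t \<otimes> u) \<otimes> ((a \<otimes> d \<oplus> b \<otimes> c) \<otimes> (s \<otimes> s'))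
        = (u \<otimes> d \<otimes> s') \<otimes> (t \<otimes> (a \<otimes> s)) \<oplus> (t \<otimes> c \<otimes> s) \<otimes> (u \<otimes> (b \<otimes> s'))"
      using assms t u by (simp add: m_ac l_distr r_distr)
    also have "\<dots> = (u \<otimes> d \<otimes> s') \<otimes> (t \<otimes> (r \<otimes> c)) \<oplus> (t \<otimes> c \<otimes> s) \<otimes> (u \<otimes> (r' \<otimes> d))"
      using t_eq u_eq by simp
    also have "\<dots> = (t \<otimes> u) \<otimes> ((r \<otimes> s' \<oplus> r' \<otimes> s) \<otimes> (c \<otimes> d))"
      using assms t u by (simp add: m_ac l_distr r_distr)
    finally have "\<exists>v\<in>denominators. v \<otimes> ((a \<otimes> d \<oplus> b \<otimes> c) \<otimes> (s \<otimes> s'))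
        = v \<otimes> ((r \<otimes> s' \<oplus> r' \<otimes> s) \<otimes> (c \<otimes> d))"
      using t u denominators_mult by blast
    then show ?thesis
      using assms t u denominators_mult by (subst fraction_eq_iff) auto
  qed
  then have "(\<Union>(a, c)\<in>Frac r s. \<Union>(b, d)\<in>Frac r' s'. Frac (a \<otimes> d \<oplus> b \<otimes> c) (c \<otimes> d))
      = (\<Union>(a, c)\<in>Frac r s. \<Union>(b, d)\<in>Frac r' s'. Frac (r \<otimes> s' \<oplus> r' \<otimes> s) (s \<otimes> s'))"
    by fast
  also have "\<dots> = Frac (r \<otimes> s' \<oplus> r' \<otimes> s) (s \<otimes> s')"
    using fraction_self[OF assms(1,2)] fraction_self[OF assms(3,4)] by auto
  finally show ?thesis
    unfolding localization_def by simp
qed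

lemma carrier_localization: "carrier L = {Frac r s |r s. r \<in> carrier R \<and> s \<in> denominators}"
  and one_localization: "\<one>\<^bsub>L\<^esub> = Frac \<one> \<one>"
  and zero_localization: "\<zero>\<^bsub>L\<^esub> = Frac \<zero> \<one>"
  by (simp_all add: localization_def)

lemma fraction_in_localization: "r \<in> carrier R \<Longrightarrow> s \<in> denominators \<Longrightarrow> Frac r s \<in> carrier L"
  unfolding carrier_localization by blast

lemma localization_cases:
  assumes "U \<in> carrier L"
  obtains r s where "U = Frac r s" "r \<in> carrier R" "s \<in> denominators"
  using assms unfolding carrier_localization by blast

lemma denominators_carrier: "s \<in> denominators \<Longrightarrow> s \<in> carrier R"
  by blast

lemmas fraction_rules = mult_fraction add_fraction denominators_mult one_denominator
  fraction_in_localization denominators_carrier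

lemma localization_is_cring: "cring L"
proof (rule cringI)
  show "abelian_group L"
  proof (rule abelian_groupI)
    fix U V W assume U: "U \<in> carrier L" and V: "V \<in> carrier L" and W: "W \<in> carrier L"
    obtain r s where rs: "U = Frac r s" "r \<in> carrier R" "s \<in> denominators"
      using U by (rule localization_cases)
    obtain r' s' where rs': "V = Frac r' s'" "r' \<in> carrier R" "s' \<in> denominators"
      using V by (rule localization_cases)
    obtain r'' s'' where rs'': "W = Frac r'' s''" "r'' \<in> carrier R" "s'' \<in> denominators"
      using W by (rule localization_cases)
    note cs = rs(2,3) rs'(2,3) rs''(2,3) denominators_carrier[OF rs(3)]
      denominators_carrier[OF rs'(3)] denominators_carrier[OF rs''(3)]
    show "U \<oplus>\<^bsub>L\<^esub> V \<in> carrier L"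
      unfolding rs rs' using cs by (simp add: fraction_rules del: Diff_iff)
    show "U \<oplus>\<^bsub>L\<^esub> V \<oplus>\<^bsub>L\<^esub> W = U \<oplus>\<^bsub>L\<^esub> (V \<oplus>\<^bsub>L\<^esub> W)"
    proof -
      have "(r \<otimes> s' \<oplus> r' \<otimes> s) \<otimes> s'' \<oplus> r'' \<otimes> (s \<otimes> s')
          = r \<otimes> (s' \<otimes> s'') \<oplus> (r' \<otimes> s'' \<oplus> r'' \<otimes> s') \<otimes> s"
        using cs by (simp add: m_ac a_ac l_distr r_distr del: Diff_iff)
      then show ?thesis
        unfolding rs rs' rs'' using cs by (simp add: fraction_rules m_assoc del: Diff_iff)
    qed
    show "U \<oplus>\<^bsub>L\<^esub> V = V \<oplus>\<^bsub>L\<^esub> U"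
      unfolding rs rs' using cs by (simp add: fraction_rules m_comm a_comm del: Diff_iff)
  next
    show "\<zero>\<^bsub>L\<^esub> \<in> carrier L"
      by (simp add: zero_localization fraction_rules del: Diff_iff)
  next
    fix U assume U: "U \<in> carrier L"
    obtain r s where rs: "U = Frac r s" "r \<in> carrier R" "s \<in> denominators"
      using U by (rule localization_cases)
    note cs = rs(2,3) denominators_carrier[OF rs(3)]
    show "\<zero>\<^bsub>L\<^esub> \<oplus>\<^bsub>L\<^esub> U = U"
      unfolding rs zero_localization using cs by (simp add: fraction_rules del: Diff_iff)
    have "Frac (\<ominus> r) s \<oplus>\<^bsub>L\<^esub> U = \<zero>\<^bsub>L\<^esub>"
      unfolding rs zero_localization using cs
      by (simp add: fraction_rules l_minus l_neg del: Diff_iff)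
        (rule fraction_eqI, simp_all add: fraction_rules del: Diff_iff)
    then show "\<exists>V\<in>carrier L. V \<oplus>\<^bsub>L\<^esub> U = \<zero>\<^bsub>L\<^esub>"
      using cs by (blast intro: fraction_in_localization a_inv_closed)
  qed
  show "comm_monoid L"
  proof (rule comm_monoidI)
    fix U V W assume U: "U \<in> carrier L" and V: "V \<in> carrier L" and W: "W \<in> carrier L"
    obtain r s where rs: "U = Frac r s" "r \<in> carrier R" "s \<in> denominators"
      using U by (rule localization_cases)
    obtain r' s' where rs': "V = Frac r' s'" "r' \<in> carrier R" "s' \<in> denominators"
      using V by (rule localization_cases)
    obtain r'' s'' where rs'': "W = Frac r'' s''" "r'' \<in> carrier R" "s'' \<in> denominators"
      using W by (rule localization_cases)
    note cs = rs(2,3) rs'(2,3) rs''(2,3) denominators_carrier[OF rs(3)]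
      denominators_carrier[OF rs'(3)] denominators_carrier[OF rs''(3)]
    show "U \<otimes>\<^bsub>L\<^esub> V \<in> carrier L" "U \<otimes>\<^bsub>L\<^esub> V = V \<otimes>\<^bsub>L\<^esub> U"
      unfolding rs rs' using cs by (simp_all add: fraction_rules m_comm del: Diff_iff)
    show "U \<otimes>\<^bsub>L\<^esub> V \<otimes>\<^bsub>L\<^esub> W = U \<otimes>\<^bsub>L\<^esub> (V \<otimes>\<^bsub>L\<^esub> W)"
      unfolding rs rs' rs'' using cs by (simp add: fraction_rules m_assoc del: Diff_iff)
  next
    show "\<one>\<^bsub>L\<^esub> \<in> carrier L"
      by (simp add: one_localization fraction_rules del: Diff_iff)
  next
    fix U assume U: "U \<in> carrier L"
    obtain r s where rs: "U = Frac r s" "r \<in> carrier R" "s \<in> denominators"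
      using U by (rule localization_cases)
    then show "\<one>\<^bsub>L\<^esub> \<otimes>\<^bsub>L\<^esub> U = U"
      by (simp add: one_localization fraction_rules del: Diff_iff)
  qed
  fix U V W assume U: "U \<in> carrier L" and V: "V \<in> carrier L" and W: "W \<in> carrier L"
  obtain r s where rs: "U = Frac r s" "r \<in> carrier R" "s \<in> denominators"
    using U by (rule localization_cases)
  obtain r' s' where rs': "V = Frac r' s'" "r' \<in> carrier R" "s' \<in> denominators"
    using V by (rule localization_cases)
  obtain r'' s'' where rs'': "W = Frac r'' s''" "r'' \<in> carrier R" "s'' \<in> denominators"
    using W by (rule localization_cases)
  note cs = rs(2,3) rs'(2,3) rs''(2,3) denominators_carrier[OF rs(3)]
    denominators_carrier[OF rs'(3)] denominators_carrier[OF rs''(3)]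
  have "(r \<otimes> s' \<oplus> r' \<otimes> s) \<otimes> r'' \<otimes> ((s \<otimes> s'') \<otimes> (s' \<otimes> s''))
      = ((r \<otimes> r'') \<otimes> (s' \<otimes> s'') \<oplus> (r' \<otimes> r'') \<otimes> (s \<otimes> s'')) \<otimes> ((s \<otimes> s') \<otimes> s'')"
    using cs by (simp add: m_ac l_distr r_distr del: Diff_iff)
  then show "(U \<oplus>\<^bsub>L\<^esub> V) \<otimes>\<^bsub>L\<^esub> W = U \<otimes>\<^bsub>L\<^esub> W \<oplus>\<^bsub>L\<^esub> V \<otimes>\<^bsub>L\<^esub> W"
    unfolding rs rs' rs'' using cs
    by (simp add: fraction_rules del: Diff_iff)
      (rule fraction_eqI, simp_all add: fraction_rules del: Diff_iff)
qed

text \<open>This bounds the ideal generated by the image of \<open>I\<close> from above, which is how an equation in \<open>R\<close> is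
  extracted from membership in a symbolic power.\<close>

lemma extended_ideal:
  assumes "ideal I R"
  shows "ideal {Frac r s |r s. r \<in> I \<and> s \<in> denominators} L" (is "ideal ?E L")
proof -
  interpret L: cring L by (rule localization_is_cring)
  interpret I: ideal I R by fact
  have memI: "Frac r s \<in> ?E" if "r \<in> I" "s \<in> denominators" for r s
    using that by blast
  have cases: "\<exists>r s. U = Frac r s \<and> r \<in> I \<and> s \<in> denominators \<and> r \<in> carrier R \<and> s \<in> carrier R"
    if "U \<in> ?E" for U
    using that I.Icarr by blast
  have add: "U \<oplus>\<^bsub>L\<^esub> V \<in> ?E" if "U \<in> ?E" "V \<in> ?E" for U V
  proof -
    obtain r s where rs: "U = Frac r s" "r \<in> I" "s \<in> denominators" "r \<in> carrier R" "s \<in> carrier R"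
      using cases[OF \<open>U \<in> ?E\<close>] by blast
    obtain r' s' where rs': "V = Frac r' s'" "r' \<in> I" "s' \<in> denominators" "r' \<in> carrier R" "s' \<in> carrier R"
      using cases[OF \<open>V \<in> ?E\<close>] by blast
    have "r \<otimes> s' \<oplus> r' \<otimes> s \<in> I"
      using rs rs' I.I_r_closed by simp
    then show ?thesis
      unfolding rs(1) rs'(1) add_fraction[OF rs(4,3) rs'(4,3)]
      using denominators_mult[OF rs(3) rs'(3)] by (rule memI)
  qed
  have mult: "V \<otimes>\<^bsub>L\<^esub> U \<in> ?E" if "U \<in> ?E" "V \<in> carrier L" for U V
  proof -
    obtain r s where rs: "U = Frac r s" "r \<in> I" "s \<in> denominators" "r \<in> carrier R" "s \<in> carrier R"
      using cases[OF \<open>U \<in> ?E\<close>] by blast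
    obtain r' s' where rs': "V = Frac r' s'" "r' \<in> carrier R" "s' \<in> denominators"
      using \<open>V \<in> carrier L\<close> by (rule localization_cases)
    have "r' \<otimes> r \<in> I"
      using rs rs' I.I_l_closed by simp
    then show ?thesis
      unfolding rs(1) rs'(1) mult_fraction[OF rs'(2,3) rs(4,3)]
      using denominators_mult[OF rs'(3) rs(3)] by (rule memI)
  qed
  have sub: "?E \<subseteq> carrier L"
    using I.Icarr fraction_in_localization by blast
  show ?thesis
  proof (rule idealI[OF L.ring_axioms])
    show "subgroup ?E (add_monoid L)"
    proof (rule L.add.subgroupI)
      show "?E \<subseteq> carrier L" by (rule sub)
      show "?E \<noteq> {}"
        using memI[OF I.zero_closed one_denominator] by blast
      fix U assume U: "U \<in> ?E"
      have "\<ominus>\<^bsub>L\<^esub> U = (\<ominus>\<^bsub>L\<^esub> \<one>\<^bsub>L\<^esub>) \<otimes>\<^bsub>L\<^esub> U"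
        using subsetD[OF sub U] by (simp add: L.l_minus)
      then show "\<ominus>\<^bsub>L\<^esub> U \<in> ?E"
        using mult[OF U] by simp
      fix V assume "V \<in> ?E"
      then show "U \<oplus>\<^bsub>L\<^esub> V \<in> ?E"
        by (rule add[OF U])
    qed
    show "V \<otimes>\<^bsub>L\<^esub> U \<in> ?E" if "U \<in> ?E" "V \<in> carrier L" for U V
      using mult that .
    then show "U \<otimes>\<^bsub>L\<^esub> V \<in> ?E" if "U \<in> ?E" "V \<in> carrier L" for U V
      using that L.m_comm[OF subsetD[OF sub that(1)] that(2)] by simp
  qed
qed

lemma contraction_of_extension:
  assumes "ideal I R" "f \<in> carrier R"
    and "Frac f \<one> \<in> Idl\<^bsub>L\<^esub> ((\<lambda>x. Frac x \<one>) ` I)"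
  shows "\<exists>t\<in>denominators. t \<otimes> f \<in> I"
proof -
  interpret I: ideal I R by fact
  have "(\<lambda>x. Frac x \<one>) ` I \<subseteq> {Frac r s |r s. r \<in> I \<and> s \<in> denominators}"
    using one_denominator by blast
  then have "Frac f \<one> \<in> {Frac r s |r s. r \<in> I \<and> s \<in> denominators}"
    using assms(3) extended_ideal[OF assms(1)] unfolding genideal_def by blast
  then obtain r s where rs: "Frac f \<one> = Frac r s" "r \<in> I" "s \<in> denominators"
    by blast
  then obtain t where t: "t \<in> denominators" "t \<otimes> (f \<otimes> s) = t \<otimes> (r \<otimes> \<one>)"
    using fraction_eq_iff[of f \<one> r s] assms(2) one_denominator I.Icarr by blast
  have "(t \<otimes> s) \<otimes> f = t \<otimes> r"
    using t rs assms(2) I.Icarr[OF rs(2)] by (simp add: m_ac)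
  then have "(t \<otimes> s) \<otimes> f \<in> I"
    using I.I_l_closed[OF rs(2)] t by simp
  then show ?thesis
    using denominators_mult[OF t(1) rs(3)] by blast
qed

lemma symbolic_powerD:
  assumes "f \<in> symbolic_power R Q n"
  shows "\<exists>t\<in>denominators. t \<otimes> f \<in> ideal_power R Q n"
proof (rule contraction_of_extension)
  interpret Ideals: comm_monoid "ideals_set R"
    by (rule ideals_set_is_comm_monoid)
  have "Q \<in> carrier (ideals_set R)"
    using ideal_axioms by (simp add: ideals_set_def)
  then have "Q [^]\<^bsub>ideals_set R\<^esub> n \<in> carrier (ideals_set R)"
    by (rule Ideals.nat_pow_closed)
  then show "ideal (ideal_power R Q n) R"
    by (simp add: ideals_set_def ideal_power_def)
qed (use assms in \<open>auto simp: symbolic_power_def\<close>)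

end

section \<open>Polynomials as finitely supported functions\<close>

abbreviation "lookup \<equiv> Poly_Mapping.lookup"
abbreviation "keys \<equiv> Poly_Mapping.keys"
abbreviation "single \<equiv> Poly_Mapping.single"

lemma poly_ring_simps [simp]:
  "f \<otimes>\<^bsub>poly_ring m\<^esub> g = f * g" "f \<oplus>\<^bsub>poly_ring m\<^esub> g = f + g"
  "\<one>\<^bsub>poly_ring m\<^esub> = 1" "\<zero>\<^bsub>poly_ring m\<^esub> = 0"
  by (simp_all add: poly_ring_def ring_of_type_algebra_def)

lemma mem_poly_ring: "f \<in> carrier (poly_ring m) \<longleftrightarrow> (\<forall>t\<in>keys f. keys t \<subseteq> {..<m})"
  by (simp add: poly_ring_def)

lemma keys_exponent_add: "keys (s + t) = keys s \<union> keys t" for s t :: "nat \<Rightarrow>\<^sub>0 nat"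
  by (auto simp: in_keys_iff lookup_add)

lemma poly_ring_add: "f \<in> carrier (poly_ring m) \<Longrightarrow> g \<in> carrier (poly_ring m) \<Longrightarrow> f + g \<in> carrier (poly_ring m)"
  using Poly_Mapping.keys_add[of f g] unfolding mem_poly_ring by blast

lemma poly_ring_mult: "f \<in> carrier (poly_ring m) \<Longrightarrow> g \<in> carrier (poly_ring m) \<Longrightarrow> f * g \<in> carrier (poly_ring m)"
  unfolding mem_poly_ring
proof
  fix t assume fg: "\<forall>t\<in>keys f. keys t \<subseteq> {..<m}" "\<forall>t\<in>keys g. keys t \<subseteq> {..<m}"
  assume "t \<in> keys (f * g)"
  then obtain a b where "t = a + b" "a \<in> keys f" "b \<in> keys g"
    using keys_mult[of f g] by blast
  then show "keys t \<subseteq> {..<m}"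
    using fg by (simp add: keys_exponent_add)
qed

lemma poly_ring_uminus: "f \<in> carrier (poly_ring m) \<Longrightarrow> - f \<in> carrier (poly_ring m)"
  by (simp add: mem_poly_ring in_keys_iff)

lemma poly_ring_diff: "f \<in> carrier (poly_ring m) \<Longrightarrow> g \<in> carrier (poly_ring m) \<Longrightarrow> f - g \<in> carrier (poly_ring m)"
  using poly_ring_add[OF _ poly_ring_uminus] by force

lemma poly_ring_single: "keys t \<subseteq> {..<m} \<Longrightarrow> single t c \<in> carrier (poly_ring m)"
  by (simp add: mem_poly_ring)

lemma poly_ring_const: "const_poly c \<in> carrier (poly_ring m)"
  unfolding const_poly_def by (rule poly_ring_single) simp

lemma poly_ring_0: "0 \<in> carrier (poly_ring m)" and poly_ring_1: "1 \<in> carrier (poly_ring m)"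
  by (simp_all add: mem_poly_ring)

lemma poly_ring_of_nat: "of_nat k \<in> carrier (poly_ring m)"
  by (induction k) (auto intro: poly_ring_0 poly_ring_1 poly_ring_add)

lemma poly_ring_power: "f \<in> carrier (poly_ring m) \<Longrightarrow> f ^ k \<in> carrier (poly_ring m)"
  by (induction k) (auto intro: poly_ring_1 poly_ring_mult)

lemma poly_ring_sum: "(\<And>x. x \<in> Y \<Longrightarrow> u x \<in> carrier (poly_ring m)) \<Longrightarrow> sum u Y \<in> carrier (poly_ring m)"
  by (induction Y rule: infinite_finite_induct) (auto intro: poly_ring_0 poly_ring_add)

lemma poly_ring_prod: "(\<And>x. x \<in> Y \<Longrightarrow> u x \<in> carrier (poly_ring m)) \<Longrightarrow> prod u Y \<in> carrier (poly_ring m)"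
  by (induction Y rule: infinite_finite_induct) (auto intro: poly_ring_1 poly_ring_mult)

lemmas poly_ring_closed = poly_ring_add poly_ring_mult poly_ring_uminus poly_ring_diff
  poly_ring_const poly_ring_0 poly_ring_1 poly_ring_of_nat poly_ring_power poly_ring_sum
  poly_ring_prod

lemma poly_eq_sum_monomials:
  fixes f :: "'a::comm_ring_1 mpoly"
  shows "f = (\<Sum>t\<in>keys f. single t (lookup f t))"
  by (rule poly_mapping_eqI)
    (auto simp: lookup_sum lookup_single when_def in_keys_iff)

lemma poly_induct [case_names zero monomial add]:
  fixes f :: "'a::comm_ring_1 mpoly"
  assumes "P 0"
    and "\<And>t. t \<in> keys f \<Longrightarrow> P (single t (lookup f t))"
    and "\<And>g h. P g \<Longrightarrow> P h \<Longrightarrow> P (g + h)"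
  shows "P f"
proof -
  have "P (\<Sum>t\<in>Y. single t (lookup f t))" if "Y \<subseteq> keys f" for Y
    using finite_subset[OF that finite_keys] that
    by (induction Y rule: finite_induct) (auto intro: assms)
  then show ?thesis
    using poly_eq_sum_monomials[of f] by force
qed

text \<open>A family of additive maps on the coefficients, one for each monomial, determines an additive map on
  polynomials. Hasse derivatives and lifts of Frobenius both arise in this way, so that their
  multiplicative properties need only be checked on monomials.\<close>

definition extend_additively ::
    "((nat \<Rightarrow>\<^sub>0 nat) \<Rightarrow> 'a \<Rightarrow> 'b::comm_monoid_add) \<Rightarrow> 'a::comm_ring_1 mpoly \<Rightarrow> 'b" where
  "extend_additively u f = (\<Sum>t\<in>keys f. u t (lookup f t))"

lemma extend_additively_zero: "extend_additively u 0 = 0"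
  by (simp add: extend_additively_def)

lemma extend_additively_single:
  assumes "u t 0 = 0"
  shows "extend_additively u (single t c) = u t c"
  using assms by (cases "c = 0") (simp_all add: extend_additively_def)

lemma extend_additively_add:
  assumes "\<And>t. u t 0 = 0" "\<And>t a b. u t (a + b) = u t a + u t b"
  shows "extend_additively u (f + g) = extend_additively u f + extend_additively u g"
  unfolding extend_additively_def
  by (rule setsum_keys_plus_distrib) (use assms in auto)

lemma lookup_const_mult: "lookup (const_poly c * f) t = c * lookup f t"
proof (induction f rule: poly_induct)
  case (monomial s)
  show ?case
    by (simp add: const_poly_def mult_single lookup_single when_def)
qed (simp_all add: distrib_left lookup_add)

lemma exponent_add_eq_0_iff: "s + t = 0 \<longleftrightarrow> s = 0 \<and> t = 0" for s t :: "nat \<Rightarrow>\<^sub>0 nat"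
  by (auto simp: poly_mapping_eq_iff fun_eq_iff lookup_add)

lemma const_coeff_mult: "lookup (f * g) 0 = lookup f 0 * lookup g 0" for f g :: "'a::comm_ring_1 mpoly"
proof (induction f rule: poly_induct)
  case (monomial s)
  show ?case
  proof (induction g rule: poly_induct)
    case (monomial t)
    show ?case
      by (auto simp: mult_single lookup_single when_def exponent_add_eq_0_iff)
  qed (simp_all add: distrib_left lookup_add)
qed (simp_all add: distrib_right lookup_add)

lemma const_coeff_power: "lookup (f ^ k) 0 = lookup f 0 ^ k" for f :: "'a::comm_ring_1 mpoly"
  by (induction k) (simp_all add: const_coeff_mult)

lemma const_coeff_const: "lookup (const_poly c) 0 = c"
  by (simp add: const_poly_def)

lemma const_poly_of_nat: "const_poly (of_nat k) = of_nat k"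
  by (simp add: const_poly_def)

lemma const_poly_mult: "const_poly (a * b) = const_poly a * const_poly b"
  by (simp add: const_poly_def mult_single)

lemma monom_deg_eq:
  assumes "finite Y" "keys t \<subseteq> Y"
  shows "monom_deg t = (\<Sum>i\<in>Y. lookup t i)"
  unfolding monom_deg_def
  by (rule sum.mono_neutral_left) (use assms in \<open>auto simp: in_keys_iff\<close>)

lemma monom_deg_add: "monom_deg (s + t) = monom_deg s + monom_deg t"
proof -
  have "finite (keys s \<union> keys t)"
    by simp
  then show ?thesis
    by (simp add: monom_deg_eq[of "keys s \<union> keys t"] keys_exponent_add lookup_add sum.distrib)
qed

lemma monom_deg_single: "monom_deg (single i k) = k"
  by (cases "k = 0") (simp_all add: monom_deg_def)

lemma monom_deg_eq_0_iff: "monom_deg t = 0 \<longleftrightarrow> t = 0"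
  by (auto simp: monom_deg_def in_keys_iff poly_mapping_eq_iff fun_eq_iff)

lemma homogeneous_single: "homogeneous (monom_deg t) (single t c)"
  by (simp add: homogeneous_def)

lemma homogeneous_add: "homogeneous d f \<Longrightarrow> homogeneous d g \<Longrightarrow> homogeneous d (f + g)"
  using Poly_Mapping.keys_add[of f g] unfolding homogeneous_def by blast

lemma homogeneous_0: "homogeneous d 0"
  by (simp add: homogeneous_def)

lemma homogeneous_sum: "(\<And>x. x \<in> Y \<Longrightarrow> homogeneous d (u x)) \<Longrightarrow> homogeneous d (sum u Y)"
  by (induction Y rule: infinite_finite_induct) (auto intro: homogeneous_add homogeneous_0)

lemma homogeneous_mult: "homogeneous d f \<Longrightarrow> homogeneous e g \<Longrightarrow> homogeneous (d + e) (f * g)"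
  using keys_mult[of f g] unfolding homogeneous_def by (fastforce simp: monom_deg_add)

lemma homogeneous_prod:
  "(\<And>x. x \<in> Y \<Longrightarrow> homogeneous 1 (u x)) \<Longrightarrow> homogeneous (card Y) (prod u Y)"
proof (induction Y rule: infinite_finite_induct)
  case (insert x Y)
  then show ?case
    using homogeneous_mult[of 1 "u x" "card Y" "prod u Y"] by simp
qed (simp_all add: homogeneous_def monom_deg_def)

lemma const_coeff_homogeneous: "homogeneous d f \<Longrightarrow> d > 0 \<Longrightarrow> lookup f 0 = 0"
  unfolding homogeneous_def using monom_deg_eq_0_iff[of 0] by (metis in_keys_iff less_numeral_extra(3))

text \<open>Each element of \<open>Y\<close> takes one variable out of the monomial. In the Noether bound \<open>Y\<close> is the group, so
  that its elements can act on the variables that they have taken.\<close>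

lemma monomial_split_variables:
  assumes "finite Y" "card Y \<le> monom_deg t"
  shows "\<exists>v t'. t = (\<Sum>x\<in>Y. single (v x) 1) + t' \<and> v ` Y \<subseteq> keys t"
  using assms
proof (induction Y arbitrary: t rule: finite_induct)
  case (insert x Y)
  then have "t \<noteq> 0"
    using monom_deg_eq_0_iff[of t] by auto
  then obtain i where i: "i \<in> keys t"
    by (meson keys_eq_empty all_not_in_conv)
  define s where "s = t - single i 1"
  have t: "t = single i 1 + s"
    using i by (intro poly_mapping_eqI)
      (auto simp: s_def lookup_add lookup_minus lookup_single when_def in_keys_iff)
  then have "card Y \<le> monom_deg s"
    using insert.prems insert.hyps by (simp add: monom_deg_add monom_deg_single)
  then obtain v t' where v: "s = (\<Sum>x\<in>Y. single (v x) 1) + t'" "v ` Y \<subseteq> keys s"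
    using insert.IH by blast
  have "(\<Sum>y\<in>Y. single ((v(x := i)) y) (1 :: nat)) = (\<Sum>y\<in>Y. single (v y) 1)"
    by (rule sum.cong) (use insert.hyps in auto)
  then have "(\<Sum>y\<in>insert x Y. single ((v(x := i)) y) (1 :: nat)) = single i 1 + (\<Sum>y\<in>Y. single (v y) 1)"
    using insert.hyps by simp
  moreover have "(v(x := i)) ` insert x Y \<subseteq> keys t"
    using v(2) insert.hyps t by (auto simp: keys_exponent_add)
  ultimately show ?case
    using t v(1) by (metis add.assoc)
qed (auto intro!: exI)

lemma single_sum_exponents: "finite Y \<Longrightarrow> single (\<Sum>x\<in>Y. e x) 1 = (\<Prod>x\<in>Y. single (e x) (1 :: 'a::comm_ring_1))"
  for e :: "'b \<Rightarrow> (nat \<Rightarrow>\<^sub>0 nat)"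
proof (induction Y rule: finite_induct)
  case (insert x Y)
  have "single (\<Sum>x\<in>insert x Y. e x) (1 :: 'a) = single (e x) 1 * single (\<Sum>x\<in>Y. e x) 1"
    using insert.hyps by (simp add: mult_single)
  then show ?case
    using insert by simp
qed simp

section \<open>Hasse derivatives\<close>

text \<open>This is the derivative \<open>(1/k!) (\<partial>/\<partial>x\<^sub>i)\<^sup>k\<close>, which the binomial coefficient defines over any ring. If
  the exponent of \<open>x\<^sub>i\<close> is less than \<open>k\<close>, then the subtraction of exponents is truncated, but the
  binomial coefficient is zero.\<close>

definition hasse :: "nat \<Rightarrow> nat \<Rightarrow> 'a::comm_ring_1 mpoly \<Rightarrow> 'a mpoly" where
  "hasse i k = extend_additively (\<lambda>t c. single (t - single i k) (of_nat (lookup t i choose k) * c))"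

lemma hasse_zero: "hasse i k 0 = 0"
  by (simp add: hasse_def extend_additively_zero)

lemma hasse_add: "hasse i k (f + g) = hasse i k f + hasse i k g"
  unfolding hasse_def by (rule extend_additively_add) (simp_all add: distrib_left single_add)

lemma hasse_single:
  "hasse i k (single t c) = single (t - single i k) (of_nat (lookup t i choose k) * c)"
  unfolding hasse_def by (rule extend_additively_single) simp

lemma lookup_hasse:
  "lookup (hasse i k f) t = of_nat ((lookup t i + k) choose k) * lookup f (t + single i k)"
proof (induction f rule: poly_induct)
  case (monomial s)
  have "t = s - single i k \<longleftrightarrow> s = t + single i k" if "k \<le> lookup s i"
    using that
    by (auto simp: poly_mapping_eq_iff fun_eq_iff lookup_add lookup_minus lookup_single when_def)
  moreover have "s \<noteq> t + single i k" if "lookup s i < k"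
    using that by (auto simp: lookup_add)
  ultimately show ?case
    by (cases "k \<le> lookup s i")
      (auto simp: hasse_single lookup_single when_def lookup_add binomial_eq_0)
qed (simp_all add: hasse_zero hasse_add lookup_add distrib_left)

lemma hasse_closed:
  assumes "f \<in> carrier (poly_ring m)"
  shows "hasse i k f \<in> carrier (poly_ring m)"
  unfolding mem_poly_ring
proof
  fix t assume "t \<in> keys (hasse i k f)"
  then have "t + single i k \<in> keys f"
    by (auto simp: in_keys_iff lookup_hasse)
  then show "keys t \<subseteq> {..<m}"
    using assms unfolding mem_poly_ring by (metis keys_exponent_add le_sup_iff)
qed

lemma hasse_0: "hasse i 0 f = f"
  by (rule poly_mapping_eqI) (simp add: lookup_hasse)

text \<open>On monomials the Leibniz rule is the Vandermonde identity for binomial coefficients.\<close>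

lemma hasse_mult:
  "hasse i k (f * g) = (\<Sum>j\<le>k. hasse i j f * hasse i (k - j) g)"
proof (induction f rule: poly_induct)
  case (monomial s)
  show ?case
  proof (induction g rule: poly_induct)
    case (monomial t)
    define a b where "a = lookup f s" and "b = lookup g t"
    let ?e = "s + t - single i k"
    have summand: "hasse i j (single s a) * hasse i (k - j) (single t b)
        = single ?e (of_nat ((lookup s i choose j) * (lookup t i choose (k - j))) * (a * b))"
      if "j \<le> k" for j
    proof (cases "j \<le> lookup s i \<and> k - j \<le> lookup t i")
      case True
      have "s - single i j + (t - single i (k - j)) = ?e"
        by (rule poly_mapping_eqI)
          (use True that in \<open>auto simp: lookup_add lookup_minus lookup_single when_def\<close>)
      then show ?thesis
        by (simp add: hasse_single mult_single mult_ac)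
    next
      case False
      then have zero: "(lookup s i choose j) * (lookup t i choose (k - j)) = 0"
        by (auto simp: binomial_eq_0_iff)
      then have zero': "of_nat (lookup s i choose j) * of_nat (lookup t i choose (k - j)) = (0 :: 'a)"
        by (metis of_nat_0 of_nat_mult)
      then have "(of_nat (lookup s i choose j) * a) * (of_nat (lookup t i choose (k - j)) * b) = 0"
        by (metis (no_types, opaque_lifting) mult.left_commute mult.assoc mult_zero_right mult.commute)
      then show ?thesis
        using zero' by (simp add: hasse_single mult_single)
    qed
    have "(\<Sum>j\<le>k. hasse i j (single s a) * hasse i (k - j) (single t b))
        = single ?e (\<Sum>j\<le>k. of_nat ((lookup s i choose j) * (lookup t i choose (k - j))) * (a * b))"
    proof -
      have "single ?e (sum u Y) = (\<Sum>j\<in>Y. single ?e (u j))" if "finite Y" for u :: "nat \<Rightarrow> 'a" and Y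
        using that by (induction Y rule: finite_induct) (simp_all add: single_add)
      then show ?thesis
        using summand by simp
    qed
    also have "\<dots> = hasse i k (single s a * single t b)"
      by (simp add: mult_single hasse_single lookup_add flip: sum_distrib_right of_nat_sum vandermonde
          del: of_nat_mult)
    finally show ?case
      by (simp add: a_def b_def)
  qed (simp_all add: hasse_zero hasse_add distrib_left sum.distrib)
qed (simp_all add: hasse_zero hasse_add distrib_right sum.distrib)

section \<open>Extending a \<open>p\<close>-derivation to polynomials\<close>

text \<open>For a ring homomorphism \<open>h\<close> of the coefficients this is the ring homomorphism that extends \<open>h\<close> and
  sends each variable to its \<open>p\<close>-th power.\<close>

definition frobenius_lift :: "nat \<Rightarrow> ('a \<Rightarrow> 'a) \<Rightarrow> 'a::comm_ring_1 mpoly \<Rightarrow> 'a mpoly" where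
  "frobenius_lift p h = extend_additively (\<lambda>t c. const_poly (h c) * single t 1 ^ p)"

text \<open>The correction term is divisible by \<open>f\<close>, which later keeps it inside an ideal containing \<open>f\<close>.\<close>

lemma power_add_mod_prime:
  fixes f g :: "'a::comm_ring_1"
  assumes "Factorial_Ring.prime p"
  shows "(f + g) ^ p = f ^ p + g ^ p
    + of_nat p * (f * (\<Sum>k\<in>{1..<p}. of_nat ((p choose k) div p) * f ^ (k - 1) * g ^ (p - k)))"
proof -
  have p: "p > 0"
    using assms prime_gt_0_nat by blast
  have middle: "of_nat (p choose k) * f ^ k * g ^ (p - k)
      = of_nat p * (f * (of_nat ((p choose k) div p) * f ^ (k - 1) * g ^ (p - k)))"
    if "k \<in> {1..<p}" for k
  proof -
    have "p dvd (p choose k)"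
      by (rule dvd_choose_prime) (use assms that in auto)
    then have "of_nat (p choose k) = (of_nat p * of_nat ((p choose k) div p) :: 'a)"
      by (metis dvd_mult_div_cancel of_nat_mult)
    moreover have "f ^ k = f * f ^ (k - 1)"
      using that by (simp add: power_eq_if)
    ultimately show ?thesis
      by (simp add: mult_ac)
  qed
  have "{..p} = insert 0 (insert p {1..<p})"
    using p by auto
  then have "(f + g) ^ p = g ^ p + f ^ p + (\<Sum>k\<in>{1..<p}. of_nat (p choose k) * f ^ k * g ^ (p - k))"
    using p by (simp add: binomial_ring)
  also have "(\<Sum>k\<in>{1..<p}. of_nat (p choose k) * f ^ k * g ^ (p - k))
      = of_nat p * (f * (\<Sum>k\<in>{1..<p}. of_nat ((p choose k) div p) * f ^ (k - 1) * g ^ (p - k)))"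
    unfolding sum_distrib_left by (rule sum.cong[OF refl middle])
  finally show ?thesis
    by (simp add: add_ac)
qed

lemma frobenius_lift_add:
  assumes "\<And>a b. h (a + b) = h a + h b"
  shows "frobenius_lift p h (f + g) = frobenius_lift p h f + frobenius_lift p h g"
proof -
  have "h 0 = 0"
    using assms[of 0 0] by simp
  then show ?thesis
    unfolding frobenius_lift_def
    by (intro extend_additively_add) (simp_all add: assms const_poly_def single_add distrib_right)
qed

lemma frobenius_lift_single:
  assumes "h 0 = 0"
  shows "frobenius_lift p h (single t c) = const_poly (h c) * single t 1 ^ p"
  unfolding frobenius_lift_def by (rule extend_additively_single) (simp add: assms const_poly_def)

lemma frobenius_lift_zero: "frobenius_lift p h 0 = 0"
  by (simp add: frobenius_lift_def extend_additively_zero)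

lemma frobenius_lift_mult:
  assumes "\<And>a b. h (a + b) = h a + h b" "\<And>a b. h (a * b) = h a * h b"
  shows "frobenius_lift p h (f * g) = frobenius_lift p h f * frobenius_lift p h g"
proof -
  have h0: "h 0 = 0"
    using assms(1)[of 0 0] by simp
  show ?thesis
  proof (induction f rule: poly_induct)
    case (monomial s)
    show ?case
    proof (induction g rule: poly_induct)
      case (monomial t)
      have "single (s + t) (1 :: 'a) ^ p = single s 1 ^ p * single t 1 ^ p"
        by (simp add: mult_single flip: power_mult_distrib)
      then show ?case
        by (simp add: mult_single frobenius_lift_single h0 assms(2) const_poly_mult
            power_mult_distrib mult_ac)
    qed (simp_all add: frobenius_lift_zero frobenius_lift_add assms(1) distrib_left)
  qed (simp_all add: frobenius_lift_zero frobenius_lift_add assms(1) distrib_right)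
qed

lemma frobenius_lift_closed:
  assumes "f \<in> carrier (poly_ring m)"
  shows "frobenius_lift p h f \<in> carrier (poly_ring m)"
  unfolding frobenius_lift_def extend_additively_def
  using assms[unfolded mem_poly_ring]
  by (intro poly_ring_sum poly_ring_mult poly_ring_power poly_ring_const poly_ring_single) blast

lemma const_coeff_frobenius_lift:
  assumes "\<And>a b. h (a + b) = h a + h b" "p > 0"
  shows "lookup (frobenius_lift p h f) 0 = h (lookup f 0)"
proof -
  have h0: "h 0 = 0"
    using assms(1)[of 0 0] by simp
  show ?thesis
  proof (induction f rule: poly_induct)
    case (monomial t)
    show ?case
      using assms(2) by (cases "t = 0") (simp_all add: frobenius_lift_single h0 const_coeff_mult
        const_coeff_power const_coeff_const lookup_single zero_power)
  qed (simp_all add: frobenius_lift_zero h0 frobenius_lift_add assms(1) lookup_add)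
qed

text \<open>Both sides are compatible with addition modulo \<open>p\<close>, and on a monomial the congruence is the one
  assumed for \<open>h\<close>, as the lift raises the variables to their \<open>p\<close>-th powers exactly.\<close>

lemma frobenius_lift_mod_prime:
  assumes "Factorial_Ring.prime p" "\<And>a b. h (a + b) = h a + h b"
    and "\<And>a. h a = a ^ p + of_nat p * \<delta> a"
    and "f \<in> carrier (poly_ring m)"
  shows "\<exists>g\<in>carrier (poly_ring m). frobenius_lift p h f = f ^ p + of_nat p * g"
proof -
  have "f \<in> carrier (poly_ring m) \<and>
      (\<exists>g\<in>carrier (poly_ring m). frobenius_lift p h f = f ^ p + of_nat p * g)"
  proof (induction f rule: poly_induct)
    case zero
    have "0 ^ p = (0 :: 'a mpoly)"
      using assms(1) prime_gt_0_nat by (simp add: zero_power)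
    then show ?case
      by (auto simp: frobenius_lift_zero poly_ring_closed intro!: bexI[of _ 0])
  next
    case (monomial t)
    let ?c = "lookup f t"
    let ?x = "single t (1 :: 'a)"
    have t: "keys t \<subseteq> {..<m}"
      using monomial assms(4) mem_poly_ring by blast
    have h0: "h 0 = 0"
      using assms(2)[of 0 0] by simp
    have pow: "const_poly (c ^ k) = const_poly c ^ k" for c :: 'a and k
      by (induction k) (simp_all add: const_poly_mult, simp add: const_poly_def)
    have "const_poly (h ?c) = const_poly ?c ^ p + of_nat p * const_poly (\<delta> ?c)"
      by (simp add: assms(3) flip: const_poly_of_nat const_poly_mult pow)
        (simp add: const_poly_def single_add)
    then have "frobenius_lift p h (single t ?c)
        = (const_poly ?c * ?x) ^ p + of_nat p * (const_poly (\<delta> ?c) * ?x ^ p)"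
      by (simp add: frobenius_lift_single h0 power_mult_distrib distrib_right distrib_left mult_ac)
    also have "const_poly ?c * ?x = single t ?c"
      by (simp add: const_poly_def mult_single)
    finally have "frobenius_lift p h (single t ?c)
        = single t ?c ^ p + of_nat p * (const_poly (\<delta> ?c) * ?x ^ p)" .
    then show ?case
      using t by (blast intro: poly_ring_closed poly_ring_single)
  next
    case (add f g)
    then obtain u v where uv: "u \<in> carrier (poly_ring m)" "v \<in> carrier (poly_ring m)"
      "frobenius_lift p h f = f ^ p + of_nat p * u" "frobenius_lift p h g = g ^ p + of_nat p * v"
      by blast
    define w where "w = f * (\<Sum>k\<in>{1..<p}. of_nat ((p choose k) div p) * f ^ (k - 1) * g ^ (p - k))"
    have w: "(f + g) ^ p = f ^ p + g ^ p + of_nat p * w" "w \<in> carrier (poly_ring m)"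
      unfolding w_def using assms(1) add
      by (blast intro: power_add_mod_prime poly_ring_closed)+
    have "frobenius_lift p h (f + g) = (f + g) ^ p + of_nat p * (u + v - w)"
      by (simp add: frobenius_lift_add assms(2) uv w(1) algebra_simps)
    then show ?case
      using add uv w(2) by (blast intro: poly_ring_closed)
  qed
  then show ?thesis
    by blast
qed

lemma add_pow_one_type: "add_pow (ring_of_type_algebra :: 'a::comm_ring_1 ring) k \<one>\<^bsub>ring_of_type_algebra\<^esub> = of_nat k"
  by (induction k) (simp_all add: add_pow_def ring_of_type_algebra_def nat_pow_def add.commute)

lemma nat_pow_type: "a [^]\<^bsub>ring_of_type_algebra\<^esub> (k :: nat) = a ^ k" for a :: "'a::comm_ring_1"
  by (induction k) (simp_all add: ring_of_type_algebra_def nat_pow_def mult.commute)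

lemma add_pow_one_poly_ring: "add_pow (poly_ring m) k \<one>\<^bsub>poly_ring m\<^esub> = of_nat k"
  by (induction k) (simp_all add: add_pow_def poly_ring_def ring_of_type_algebra_def nat_pow_def add.commute)

lemma nat_pow_poly_ring: "f [^]\<^bsub>poly_ring m\<^esub> (k :: nat) = f ^ k"
  by (induction k) (simp_all add: poly_ring_def ring_of_type_algebra_def nat_pow_def mult.commute)

lemma p_derivation_type_iff:
  "p_derivation (ring_of_type_algebra :: 'a::comm_ring_1 ring) p \<delta> \<longleftrightarrow>
     (\<forall>x. of_nat p * x = (0 :: 'a) \<longrightarrow> x = 0) \<and>
     (\<lambda>x. x ^ p + of_nat p * \<delta> x) \<in> ring_hom ring_of_type_algebra (ring_of_type_algebra :: 'a ring)"
  unfolding p_derivation_def nonzerodivisor_def add_pow_one_type nat_pow_type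
  by (simp add: ring_of_type_algebra_def)

lemma p_derivation_poly_ring_iff:
  fixes \<Delta> :: "'a::comm_ring_1 mpoly \<Rightarrow> 'a mpoly"
  shows "p_derivation (poly_ring m) p \<Delta> \<longleftrightarrow>
     (\<forall>f\<in>carrier (poly_ring m). of_nat p * f = (0 :: 'a mpoly) \<longrightarrow> f = 0) \<and>
     \<Delta> \<in> carrier (poly_ring m) \<rightarrow> carrier (poly_ring m) \<and>
     (\<lambda>f. f ^ p + of_nat p * \<Delta> f) \<in> ring_hom (poly_ring m) (poly_ring m)"
  unfolding p_derivation_def nonzerodivisor_def add_pow_one_poly_ring nat_pow_poly_ring
  by (simp add: poly_ring_of_nat)

text \<open>Dividing the difference of the lifted Frobenius and the \<open>p\<close>-th power by \<open>p\<close> gives the extension.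
  Constant terms are compatible since setting all variables to zero commutes with both maps.\<close>

lemma p_derivation_extends_to_polynomials:
  fixes \<delta> :: "'a::idom \<Rightarrow> 'a"
  assumes "Factorial_Ring.prime p" "p_derivation ring_of_type_algebra p \<delta>"
  shows "\<exists>\<Delta>. p_derivation (poly_ring m) p \<Delta> \<and>
    (\<forall>f\<in>carrier (poly_ring m). lookup (\<Delta> f) 0 = \<delta> (lookup f 0))"
proof -
  define h where "h = (\<lambda>x. x ^ p + of_nat p * \<delta> x)"
  have hom: "h \<in> ring_hom ring_of_type_algebra ring_of_type_algebra"
    using assms(2) unfolding p_derivation_type_iff h_def by blast
  have h: "h (a + b) = h a + h b" "h (a * b) = h a * h b" "h 1 = 1" for a b
    using hom by (simp_all add: ring_hom_def ring_of_type_algebra_def)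
  have p: "of_nat p \<noteq> (0 :: 'a)"
    using assms(2) unfolding p_derivation_type_iff by (metis mult_zero_left zero_neq_one)
  have "\<forall>f\<in>carrier (poly_ring m). \<exists>g. g \<in> carrier (poly_ring m)
      \<and> frobenius_lift p h f = f ^ p + of_nat p * g"
    using frobenius_lift_mod_prime[OF assms(1) h(1), of \<delta>] h_def by blast
  then obtain \<Delta> where \<Delta>: "\<And>f. f \<in> carrier (poly_ring m) \<Longrightarrow> \<Delta> f \<in> carrier (poly_ring m)"
    "\<And>f. f \<in> carrier (poly_ring m) \<Longrightarrow> frobenius_lift p h f = f ^ p + of_nat p * \<Delta> f"
    by metis
  have "h 0 = 0"
    using h(1)[of 0 0] by (metis add_0 add_cancel_right_right)
  then have frobenius_1: "frobenius_lift p h 1 = 1"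
    using frobenius_lift_single[of h p 0 1] h(3) by (simp add: const_poly_def)
  have "of_nat p \<noteq> (0 :: 'a mpoly)"
    using p by (metis const_coeff_const const_poly_of_nat lookup_zero)
  moreover from this have "\<Delta> 1 = 0"
    using \<Delta>(2)[OF poly_ring_1] frobenius_1 by simp
  ultimately have "p_derivation (poly_ring m) p \<Delta>"
    unfolding p_derivation_poly_ring_iff
    by (auto intro!: ring_hom_memI simp: \<Delta>(1) poly_ring_closed frobenius_lift_closed
        frobenius_lift_add frobenius_lift_mult h simp flip: \<Delta>(2))
  moreover have "lookup (\<Delta> f) 0 = \<delta> (lookup f 0)" if "f \<in> carrier (poly_ring m)" for f
  proof -
    have "h (lookup f 0) = lookup (f ^ p + of_nat p * \<Delta> f) 0"
      using const_coeff_frobenius_lift[of h p f] h(1) assms(1) prime_gt_0_nat \<Delta>(2)[OF that] by simp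
    then have "of_nat p * lookup (\<Delta> f) 0 = of_nat p * \<delta> (lookup f 0)"
      by (auto simp: h_def lookup_add const_coeff_power lookup_const_mult simp flip: const_poly_of_nat)
    then show ?thesis
      using p by simp
  qed
  ultimately show ?thesis
    by blast
qed

lemma p_derivation_poly_add:
  fixes \<Delta> :: "'a::idom mpoly \<Rightarrow> 'a mpoly"
  assumes "Factorial_Ring.prime p" "p_derivation (poly_ring m) p \<Delta>"
    and "f \<in> carrier (poly_ring m)" "g \<in> carrier (poly_ring m)"
  shows "\<exists>h\<in>carrier (poly_ring m). \<Delta> (f + g) = \<Delta> f + \<Delta> g + f * h"
proof -
  have zerodiv: "h = 0" if "of_nat p * h = 0" "h \<in> carrier (poly_ring m)" for h :: "'a mpoly"
    using that assms(2) unfolding p_derivation_poly_ring_iff by blast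
  have \<Delta>: "\<Delta> h \<in> carrier (poly_ring m)" if "h \<in> carrier (poly_ring m)" for h :: "'a mpoly"
    using that assms(2) unfolding p_derivation_poly_ring_iff by blast
  have "(f + g) ^ p + of_nat p * \<Delta> (f + g) = (f ^ p + of_nat p * \<Delta> f) + (g ^ p + of_nat p * \<Delta> g)"
    using assms(2-4) by (simp add: p_derivation_poly_ring_iff ring_hom_def)
  moreover define w where "w = (\<Sum>k\<in>{1..<p}. of_nat ((p choose k) div p) * f ^ (k - 1) * g ^ (p - k))"
  ultimately have "of_nat p * (\<Delta> (f + g) - (\<Delta> f + \<Delta> g + f * (- w))) = 0"
    using power_add_mod_prime[OF assms(1), of f g] by (simp add: algebra_simps)
  moreover have w: "w \<in> carrier (poly_ring m)"
    unfolding w_def using assms by (blast intro: poly_ring_closed)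
  ultimately have "\<Delta> (f + g) = \<Delta> f + \<Delta> g + f * (- w)"
    using zerodiv \<Delta> assms(3,4) by (meson eq_iff_diff_eq_0 poly_ring_closed)
  then show ?thesis
    using w by (blast intro: poly_ring_uminus)
qed

lemma p_derivation_poly_mult:
  fixes \<Delta> :: "'a::idom mpoly \<Rightarrow> 'a mpoly"
  assumes "p_derivation (poly_ring m) p \<Delta>"
    and "f \<in> carrier (poly_ring m)" "g \<in> carrier (poly_ring m)"
  shows "\<Delta> (f * g) = f ^ p * \<Delta> g + g ^ p * \<Delta> f + of_nat p * \<Delta> f * \<Delta> g"
proof -
  have zerodiv: "h = 0" if "of_nat p * h = 0" "h \<in> carrier (poly_ring m)" for h :: "'a mpoly"
    using that assms(1) unfolding p_derivation_poly_ring_iff by blast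
  have \<Delta>: "\<Delta> h \<in> carrier (poly_ring m)" if "h \<in> carrier (poly_ring m)" for h :: "'a mpoly"
    using that assms(1) unfolding p_derivation_poly_ring_iff by blast
  have "(f * g) ^ p + of_nat p * \<Delta> (f * g) = (f ^ p + of_nat p * \<Delta> f) * (g ^ p + of_nat p * \<Delta> g)"
    using assms by (simp add: p_derivation_poly_ring_iff ring_hom_def)
  then have "of_nat p * (\<Delta> (f * g) - (f ^ p * \<Delta> g + g ^ p * \<Delta> f + of_nat p * \<Delta> f * \<Delta> g)) = 0"
    by (simp add: algebra_simps power_mult_distrib)
  then show ?thesis
    using zerodiv \<Delta> assms(2,3) by (meson eq_iff_diff_eq_0 poly_ring_closed)
qed

section \<open>Arithmetic in the discrete valuation ring\<close>

lemma uniformizer_generates_unique_maximal: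
  assumes "discrete_valuation_ring A" "uniformizer A u" "maximalideal M A"
  shows "M = PIdl\<^bsub>A\<^esub> u"
proof -
  interpret discrete_valuation_ring A by fact
  show ?thesis
    using unique_maximal assms(2,3) unfolding uniformizer_def by blast
qed

text \<open>In a principal ideal domain a generator of a nonzero prime ideal is irreducible, hence the ideal is
  maximal.\<close>

lemma prime_ideal_in_dvr:
  assumes "discrete_valuation_ring A" "uniformizer A u" "primeideal P A"
  shows "P = {\<zero>\<^bsub>A\<^esub>} \<or> P = PIdl\<^bsub>A\<^esub> u"
proof -
  interpret A: discrete_valuation_ring A by fact
  interpret P: primeideal P A by fact
  obtain c where c: "c \<in> carrier A" "P = PIdl\<^bsub>A\<^esub> c"
    using A.exists_gen[OF P.ideal_axioms] by blast
  show ?thesis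
  proof (cases "c = \<zero>\<^bsub>A\<^esub>")
    case True
    have "x = \<zero>\<^bsub>A\<^esub>" if "x \<in> P" for x
    proof -
      have "x \<in> PIdl\<^bsub>A\<^esub> \<zero>\<^bsub>A\<^esub>"
        using that unfolding c(2) True .
      then obtain y where "y \<in> carrier A" "x = y \<otimes>\<^bsub>A\<^esub> \<zero>\<^bsub>A\<^esub>"
        unfolding cgenideal_def by blast
      then show ?thesis
        by simp
    qed
    then show ?thesis
      using P.zero_closed by blast
  next
    case False
    then have "ring_irreducible\<^bsub>A\<^esub> c"
      using A.primeideal_iff_prime[of c] A.primeness_condition[OF c(1)] P.primeideal_axioms c
      by (metis DiffI singletonD)
    then have "maximalideal P A"
      unfolding c(2) by (rule A.irreducible_imp_maximalideal[OF c(1)])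
    then have "P = PIdl\<^bsub>A\<^esub> u"
      by (rule uniformizer_generates_unique_maximal[OF assms(1,2)])
    then show ?thesis ..
  qed
qed

lemma nonunit_in_dvr:
  assumes "discrete_valuation_ring A" "uniformizer A u" "a \<in> carrier A" "a \<notin> Units A"
  shows "a \<in> PIdl\<^bsub>A\<^esub> u"
proof -
  interpret A: discrete_valuation_ring A by fact
  have u: "u \<in> carrier A"
    using assms(2) unfolding uniformizer_def by blast
  show ?thesis
  proof (cases "a = \<zero>\<^bsub>A\<^esub>")
    case True
    then show ?thesis
      using A.cgenideal_ideal[OF u] by (simp add: additive_subgroup.zero_closed ideal.axioms(1))
  next
    case False
    then have "a \<in> carrier A - {\<zero>\<^bsub>A\<^esub>}"
      using assms(3) by blast
    then obtain b where b: "b \<in> carrier A" "ring_irreducible\<^bsub>A\<^esub> b" "b divides\<^bsub>A\<^esub> a"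
      using assms(4) by (rule A.exists_irreducible_divisor)
    have "PIdl\<^bsub>A\<^esub> b = PIdl\<^bsub>A\<^esub> u"
      by (rule uniformizer_generates_unique_maximal[OF assms(1,2)
            A.irreducible_imp_maximalideal[OF b(1,2)]])
    then show ?thesis
      using A.to_contain_is_to_divide[OF b(1) assms(3)] b(3) A.cgenideal_self[OF assms(3)]
      by (metis subsetD)
  qed
qed

context
  fixes p :: nat
  assumes dvr: "discrete_valuation_ring (ring_of_type_algebra :: 'a::idom ring)"
    and unif: "uniformizer (ring_of_type_algebra :: 'a ring)
      (add_pow (ring_of_type_algebra :: 'a ring) p \<one>\<^bsub>ring_of_type_algebra\<^esub>)"
begin

lemma PIdl_uniformizer_type:
  "c \<in> PIdl\<^bsub>ring_of_type_algebra\<^esub> (of_nat p :: 'a) \<longleftrightarrow> of_nat p dvd c"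
  by (auto simp: cgenideal_def ring_of_type_algebra_def dvd_def mult.commute)

lemma uniformizer_type: "uniformizer (ring_of_type_algebra :: 'a ring) (of_nat p)"
  using unif by (simp only: add_pow_one_type)

lemma not_uniformizer_dvd_one: "\<not> of_nat p dvd (1 :: 'a)"
proof -
  interpret maximalideal "PIdl\<^bsub>ring_of_type_algebra\<^esub> (of_nat p :: 'a)" "ring_of_type_algebra :: 'a ring"
    using uniformizer_type unfolding uniformizer_def by blast
  have "1 \<notin> PIdl\<^bsub>ring_of_type_algebra\<^esub> (of_nat p :: 'a)"
    using I_notcarr one_imp_carrier by (auto simp: ring_of_type_algebra_def)
  then show ?thesis
    using PIdl_uniformizer_type by blast
qed

lemma uniformizer_prime_dvd:
  assumes "of_nat p dvd (a * b :: 'a)"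
  shows "of_nat p dvd a \<or> of_nat p dvd b"
proof -
  interpret A: cring "ring_of_type_algebra :: 'a ring"
    by (rule cring_from_type_algebra)
  have "primeideal (PIdl\<^bsub>ring_of_type_algebra\<^esub> (of_nat p :: 'a)) ring_of_type_algebra"
    using A.maximalideal_prime uniformizer_type unfolding uniformizer_def by blast
  then interpret primeideal "PIdl\<^bsub>ring_of_type_algebra\<^esub> (of_nat p :: 'a)" "ring_of_type_algebra :: 'a ring" .
  show ?thesis
    using I_prime[of a b] assms PIdl_uniformizer_type by (simp add: ring_of_type_algebra_def)
qed

text \<open>Otherwise \<open>D\<close> would be a multiple of the uniformizer \<open>p\<close>, and a Bezout relation between the two coprime
  integers would make \<open>1\<close> a multiple of \<open>p\<close> as well.\<close>

lemma of_nat_invertible: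
  assumes "coprime D p"
  shows "\<exists>e :: 'a. of_nat D * e = 1"
proof (rule ccontr)
  assume no_inverse: "\<nexists>e :: 'a. of_nat D * e = 1"
  then have "(of_nat D :: 'a) \<notin> Units ring_of_type_algebra"
    by (auto simp: Units_def ring_of_type_algebra_def)
  then have "(of_nat D :: 'a) \<in> PIdl\<^bsub>ring_of_type_algebra\<^esub> (of_nat p)"
    using nonunit_in_dvr[OF dvr uniformizer_type] by (simp add: ring_of_type_algebra_def)
  then have p_dvd: "of_nat p dvd (of_nat D :: 'a)"
    using PIdl_uniformizer_type by blast
  obtain x y :: int where "x * int D + y * int p = 1"
    using assms bezout_int[of "int D" "int p"] by auto
  then have "of_int x * of_nat D + of_int y * of_nat p = (1 :: 'a)"
    by (metis of_int_1 of_int_add of_int_mult of_int_of_nat_eq)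
  then have "of_nat p dvd (1 :: 'a)"
    using p_dvd by (metis dvd_add dvd_mult dvd_refl)
  then show False
    using not_uniformizer_dvd_one by blast
qed

lemma prime_ideal_type:
  assumes "primeideal P (ring_of_type_algebra :: 'a ring)"
  shows "P = {0} \<or> P = {c. of_nat p dvd c}"
  using prime_ideal_in_dvr[OF dvr uniformizer_type assms] PIdl_uniformizer_type
  by (auto simp: ring_of_type_algebra_def)

text \<open>The lift of Frobenius \<open>h\<close> fixes \<open>p\<close> and preserves non-divisibility by \<open>p\<close>, so it preserves the
  valuation, whereas the \<open>p\<close>-th power multiplies it by \<open>p\<close>. For a positive valuation the difference
  \<open>h c - c\<^sup>p = p \<delta>(c)\<close> therefore has the valuation of \<open>c\<close>. The valuation of \<open>c\<close> is \<open>j + 1\<close> here.\<close>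

lemma p_derivation_lowers_valuation:
  fixes \<delta> :: "'a \<Rightarrow> 'a"
  assumes "p_derivation ring_of_type_algebra p \<delta>" "p > 1"
    and "of_nat p ^ Suc j dvd c" "\<not> of_nat p ^ Suc (Suc j) dvd c"
  shows "of_nat p ^ j dvd \<delta> c \<and> \<not> of_nat p ^ Suc j dvd \<delta> c"
proof -
  let ?p = "of_nat p :: 'a"
  define h where "h = (\<lambda>x. x ^ p + of_nat p * \<delta> x)"
  have hom: "h \<in> ring_hom ring_of_type_algebra ring_of_type_algebra"
    using assms(1) unfolding p_derivation_type_iff h_def by blast
  have h: "h (a + b) = h a + h b" "h (a * b) = h a * h b" "h 1 = 1" for a b
    using hom by (simp_all add: ring_hom_def ring_of_type_algebra_def)
  have h0: "h 0 = 0"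
    using h(1)[of 0 0] by (metis add_0 add_cancel_right_right)
  have h_nat: "h (of_nat k) = of_nat k" for k
    by (induction k) (simp_all add: h h0)
  have h_pow: "h (x ^ k) = h x ^ k" for x k
    by (induction k) (simp_all add: h)
  have p: "?p \<noteq> 0"
    using assms(1) unfolding p_derivation_type_iff by (metis mult_zero_left zero_neq_one)
  obtain v where v: "c = ?p ^ Suc j * v"
    using assms(3) by blast
  have not_dvd: "\<not> ?p dvd v"
    using assms(4) v by (metis dvd_triv_left mult.assoc mult_dvd_mono dvd_refl power_Suc2)
  have "\<not> ?p dvd v ^ k" for k
    by (induction k) (use not_dvd uniformizer_prime_dvd not_uniformizer_dvd_one in auto)
  then have not_dvd': "\<not> ?p dvd h v"
    unfolding h_def by (metis dvd_add_left_iff dvd_triv_left)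
  \<comment> \<open>The quotient of \<open>h c - c\<^sup>p\<close> by \<open>p\<close> to the power \<open>j + 1\<close>; it is congruent to \<open>h v\<close> modulo \<open>p\<close>.\<close>
  define w where "w = h v - ?p ^ (Suc j * p - Suc j) * v ^ p"
  have "Suc j < Suc j * p"
    using assms(2) by (intro n_less_n_mult_m) simp_all
  then have exponent: "Suc j * p = Suc j + (Suc j * p - Suc j)" "Suc j * p - Suc j > 0"
    by (simp_all only: le_add_diff_inverse less_imp_le zero_less_diff)
  have "?p * \<delta> c = h c - c ^ p"
    by (simp add: h_def)
  also have "\<dots> = ?p ^ Suc j * h v - ?p ^ (Suc j * p) * v ^ p"
    unfolding v by (simp only: h(2) h_pow h_nat power_mult_distrib power_mult)
  also have "\<dots> = ?p * (?p ^ j * w)"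
    by (subst exponent(1)) (simp add: w_def power_add algebra_simps)
  finally have \<delta>c: "\<delta> c = ?p ^ j * w"
    using p by simp
  have "?p dvd ?p ^ (Suc j * p - Suc j) * v ^ p"
    using exponent(2) by (simp add: dvd_mult2 dvd_power)
  then have "\<not> ?p dvd w"
    using not_dvd' unfolding w_def by (metis diff_add_cancel dvd_add)
  then have "\<not> ?p ^ Suc j dvd \<delta> c"
    using p unfolding \<delta>c by (simp add: mult.commute)
  then show ?thesis
    using \<delta>c by simp
qed

end

section \<open>Invariants of a finite group of invertible order\<close>

locale nonmodular_invariants = graded_algebra_action G m \<phi>
  for G (structure) and m :: nat and \<phi> :: "'g \<Rightarrow> 'a::comm_ring_1 mpoly \<Rightarrow> 'a mpoly" +
  fixes order_inverse :: 'a
  assumes finite_group: "finite (carrier G)"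
    and order_inverse: "of_nat (Coset.order G) * order_inverse = 1"
begin

abbreviation "S \<equiv> carrier (poly_ring m)"
abbreviation "R \<equiv> invariant_ring G m \<phi>"

lemma group_G: "Group.group G"
  using group_hom group_hom.axioms(1) by blast

lemma mem_R: "f \<in> carrier R \<longleftrightarrow> f \<in> S \<and> (\<forall>g\<in>carrier G. \<phi> g f = f)"
  by (auto simp: invariant_ring_def)

lemma R_simps [simp]:
  "f \<otimes>\<^bsub>R\<^esub> g = f * g" "f \<oplus>\<^bsub>R\<^esub> g = f + g" "\<one>\<^bsub>R\<^esub> = 1" "\<zero>\<^bsub>R\<^esub> = 0"
  by (simp_all add: invariant_ring_def poly_ring_def ring_of_type_algebra_def)

lemma R_subset_S: "f \<in> carrier R \<Longrightarrow> f \<in> S"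
  by (simp add: mem_R)

lemma act_closed: "g \<in> carrier G \<Longrightarrow> f \<in> S \<Longrightarrow> \<phi> g f \<in> S"
  using element_image by blast

lemma act_add: "g \<in> carrier G \<Longrightarrow> f \<in> S \<Longrightarrow> h \<in> S \<Longrightarrow> \<phi> g (f + h) = \<phi> g f + \<phi> g h"
  using ring_hom_add[OF ring_hom] by simp

lemma act_mult: "g \<in> carrier G \<Longrightarrow> f \<in> S \<Longrightarrow> h \<in> S \<Longrightarrow> \<phi> g (f * h) = \<phi> g f * \<phi> g h"
  using ring_hom_mult[OF ring_hom] by simp

lemma act_one: "g \<in> carrier G \<Longrightarrow> \<phi> g 1 = 1"
  using ring_hom_one[OF ring_hom] by simp

lemma act_zero: "g \<in> carrier G \<Longrightarrow> \<phi> g 0 = 0"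
  using fixes_const[of g 0] by (simp add: const_poly_def)

lemma act_sum:
  "g \<in> carrier G \<Longrightarrow> (\<And>y. y \<in> Y \<Longrightarrow> u y \<in> S) \<Longrightarrow> \<phi> g (sum u Y) = (\<Sum>y\<in>Y. \<phi> g (u y))"
  by (induction Y rule: infinite_finite_induct) (simp_all add: act_zero act_add poly_ring_sum)

lemma act_prod:
  "g \<in> carrier G \<Longrightarrow> (\<And>y. y \<in> Y \<Longrightarrow> u y \<in> S) \<Longrightarrow> \<phi> g (prod u Y) = (\<Prod>y\<in>Y. \<phi> g (u y))"
  by (induction Y rule: infinite_finite_induct) (simp_all add: act_one act_mult poly_ring_prod)

lemma act_id: "f \<in> S \<Longrightarrow> \<phi> \<one> f = f"
  using id_eq_one by (metis restrict_apply')

text \<open>The group fixes constants and preserves degrees, so no monomial of positive degree can contribute to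
  a constant term.\<close>

lemma const_coeff_act:
  assumes "g \<in> carrier G" "f \<in> S"
  shows "lookup (\<phi> g f) 0 = lookup f 0"
proof -
  have "\<phi> g f \<in> S \<and> lookup (\<phi> g f) 0 = lookup f 0 \<and> f \<in> S"
  proof (induction f rule: poly_induct)
    case zero
    show ?case
      using assms(1) by (simp add: act_zero poly_ring_0)
  next
    case (monomial t)
    let ?f = "single t (lookup f t)"
    have S: "?f \<in> S"
      using monomial assms(2) unfolding mem_poly_ring by (simp add: poly_ring_single)
    show ?case
    proof (cases "t = 0")
      case True
      then have "\<phi> g ?f = ?f"
        using fixes_const[OF assms(1), of "lookup f t"] by (simp add: const_poly_def)
      then show ?thesis
        using S by simp
    next
      case False
      then have "monom_deg t > 0"
        using monom_deg_eq_0_iff[of t] by simp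
      then have "lookup (\<phi> g ?f) 0 = 0" "lookup ?f 0 = 0"
        using degree_preserving[OF assms(1) S homogeneous_single] homogeneous_single
        by (blast intro: const_coeff_homogeneous)+
      then show ?thesis
        using S act_closed[OF assms(1)] by simp
    qed
  qed (use assms(1) in \<open>simp add: act_add lookup_add poly_ring_add\<close>)
  then show ?thesis
    by blast
qed

lemma R_const: "const_poly c \<in> carrier R"
  by (simp add: mem_R poly_ring_const fixes_const)

lemma R_zero: "0 \<in> carrier R" and R_one: "1 \<in> carrier R"
  by (simp_all add: mem_R poly_ring_0 poly_ring_1 act_zero act_one)

lemma R_add: "f \<in> carrier R \<Longrightarrow> g \<in> carrier R \<Longrightarrow> f + g \<in> carrier R"
  by (simp add: mem_R act_add poly_ring_add)

lemma R_mult: "f \<in> carrier R \<Longrightarrow> g \<in> carrier R \<Longrightarrow> f * g \<in> carrier R"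
  by (simp add: mem_R act_mult poly_ring_mult)

lemma R_uminus: "f \<in> carrier R \<Longrightarrow> - f \<in> carrier R"
  using R_mult[OF R_const[of "- 1"]] by (simp add: const_poly_def single_uminus)

lemma R_power: "f \<in> carrier R \<Longrightarrow> f ^ k \<in> carrier R"
  by (induction k) (simp_all add: R_one R_mult)

lemma cring_R: "cring R"
proof (rule cringI)
  show "abelian_group R"
  proof (rule abelian_groupI)
    fix f assume "f \<in> carrier R"
    then show "\<exists>g\<in>carrier R. g \<oplus>\<^bsub>R\<^esub> f = \<zero>\<^bsub>R\<^esub>"
      using R_uminus by force
  qed (simp_all add: R_zero R_add add_ac)
  show "comm_monoid R"
    by (rule comm_monoidI) (simp_all add: R_one R_mult mult_ac)
qed (simp add: distrib_right)

definition transfer :: "'a mpoly \<Rightarrow> 'a mpoly" where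
  "transfer f = (\<Sum>g\<in>carrier G. \<phi> g f)"

definition reynolds :: "'a mpoly \<Rightarrow> 'a mpoly" where
  "reynolds f = const_poly order_inverse * transfer f"

lemma transfer_closed:
  assumes "f \<in> S"
  shows "transfer f \<in> carrier R"
  unfolding mem_R
proof (intro conjI ballI)
  interpret G: Group.group G by (rule group_G)
  show "transfer f \<in> S"
    unfolding transfer_def using assms act_closed by (blast intro: poly_ring_sum)
  fix g assume g: "g \<in> carrier G"
  have "\<phi> g (transfer f) = (\<Sum>h\<in>carrier G. \<phi> (g \<otimes> h) f)"
    unfolding transfer_def using g assms act_closed
    by (subst act_sum) (auto intro!: sum.cong simp: composition_rule)
  also have "\<dots> = transfer f"
    unfolding transfer_def
  proof (rule sum.reindex_bij_betw)
    show "bij_betw (\<lambda>h. g \<otimes> h) (carrier G) (carrier G)"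
      using G.inj_on_cmult[OF g] G.surj_const_mult[OF g] unfolding bij_betw_def by simp
  qed
  finally show "\<phi> g (transfer f) = transfer f" .
qed

lemma reynolds_closed: "f \<in> S \<Longrightarrow> reynolds f \<in> carrier R"
  unfolding reynolds_def by (intro R_mult R_const transfer_closed)

lemma reynolds_add: "f \<in> S \<Longrightarrow> g \<in> S \<Longrightarrow> reynolds (f + g) = reynolds f + reynolds g"
  by (simp add: reynolds_def transfer_def act_add sum.distrib distrib_left)

lemma reynolds_mult_invariant: "r \<in> carrier R \<Longrightarrow> f \<in> S \<Longrightarrow> reynolds (r * f) = r * reynolds f"
  by (simp add: reynolds_def transfer_def mem_R act_mult sum_distrib_left mult.left_commute)

lemma reynolds_invariant:
  assumes "r \<in> carrier R"
  shows "reynolds r = r"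
proof -
  have "transfer r = const_poly (of_nat (Coset.order G)) * r"
    using assms by (simp add: transfer_def mem_R Coset.order_def const_poly_of_nat)
  then have "reynolds r = const_poly (order_inverse * of_nat (Coset.order G)) * r"
    by (simp add: reynolds_def const_poly_mult mult.assoc)
  then show ?thesis
    using order_inverse by (simp add: mult.commute const_poly_def)
qed

lemma reynolds_zero: "reynolds 0 = 0"
  by (rule reynolds_invariant[OF R_zero])

lemma const_coeff_reynolds: "f \<in> S \<Longrightarrow> lookup (reynolds f) 0 = lookup f 0"
  using order_inverse
  by (simp add: reynolds_def transfer_def lookup_const_mult lookup_sum const_coeff_act
      Coset.order_def mult_ac)
    (metis mult.assoc mult.commute mult_1)

text \<open>For every \<open>h\<close> in \<open>G\<close> the product of the differences \<open>a\<^sub>g - h g a\<^sub>g\<close> over all \<open>g\<close> vanishes, because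
  its factor at the inverse of \<open>h\<close> does. Expanding the product and summing over \<open>h\<close> gives the identity:
  the empty subset contributes the left-hand side, and each of the other subsets \<open>Y\<close> contributes a
  multiple of an invariant, the transfer of the product of the \<open>g a\<^sub>g\<close> with \<open>g\<close> in \<open>Y\<close>.\<close>

lemma prod_eq_sum_transfers:
  assumes "\<And>g. g \<in> carrier G \<Longrightarrow> a g \<in> S"
  shows "of_nat (Coset.order G) * (\<Prod>g\<in>carrier G. a g)
    = (\<Sum>Y\<in>Pow (carrier G) - {{}}.
        (- 1) ^ Suc (card Y) * transfer (\<Prod>g\<in>Y. \<phi> g (a g)) * (\<Prod>g\<in>carrier G - Y. a g))"
proof -
  interpret G: Group.group G by (rule group_G)
  let ?rest = "\<lambda>Y. \<Prod>g\<in>carrier G - Y. a g"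
  have vanish: "(\<Prod>g\<in>carrier G. a g - \<phi> (h \<otimes> g) (a g)) = 0" if h: "h \<in> carrier G" for h
  proof (rule prod_zero[OF finite_group])
    show "\<exists>g\<in>carrier G. a g - \<phi> (h \<otimes> g) (a g) = 0"
      using h assms[of "inv h"] act_id by (intro bexI[of _ "inv h"]) auto
  qed
  have expand: "(\<Prod>g\<in>carrier G. a g - \<phi> (h \<otimes> g) (a g))
      = (\<Sum>Y\<in>Pow (carrier G). (- 1) ^ card Y * \<phi> h (\<Prod>g\<in>Y. \<phi> g (a g)) * ?rest Y)"
    if h: "h \<in> carrier G" for h
    unfolding prod_diff_conv_sum[OF finite_group]
  proof (rule sum.cong[OF refl])
    fix Y assume Y: "Y \<in> Pow (carrier G)"
    have "\<phi> h (\<Prod>g\<in>Y. \<phi> g (a g)) = (\<Prod>g\<in>Y. \<phi> h (\<phi> g (a g)))"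
      using h Y assms act_closed by (intro act_prod) auto
    also have "\<dots> = (\<Prod>g\<in>Y. \<phi> (h \<otimes> g) (a g))"
      using h Y assms by (intro prod.cong) (auto simp: composition_rule)
    finally show "(- 1) ^ card Y * (\<Prod>g\<in>Y. \<phi> (h \<otimes> g) (a g)) * ?rest Y
        = (- 1) ^ card Y * \<phi> h (\<Prod>g\<in>Y. \<phi> g (a g)) * ?rest Y"
      by simp
  qed
  have "0 = (\<Sum>h\<in>carrier G. \<Sum>Y\<in>Pow (carrier G).
      (- 1) ^ card Y * \<phi> h (\<Prod>g\<in>Y. \<phi> g (a g)) * ?rest Y)"
    using vanish expand by simp
  also have "\<dots> = (\<Sum>Y\<in>Pow (carrier G).
      (- 1) ^ card Y * transfer (\<Prod>g\<in>Y. \<phi> g (a g)) * ?rest Y)"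
    by (subst sum.swap) (simp add: transfer_def sum_distrib_left sum_distrib_right)
  also have "\<dots> = transfer 1 * ?rest {}
      + (\<Sum>Y\<in>Pow (carrier G) - {{}}. (- 1) ^ card Y * transfer (\<Prod>g\<in>Y. \<phi> g (a g)) * ?rest Y)"
    by (subst sum.remove[of _ "{}"]) (simp_all add: finite_group)
  also have "transfer 1 = of_nat (Coset.order G)"
    by (simp add: transfer_def act_one Coset.order_def)
  finally show ?thesis
    by (simp add: sum_negf eq_neg_iff_add_eq_0)
qed

text \<open>The largest ideal of \<open>S\<close> that the Reynolds operator maps into \<open>I\<close>. It contains the extension \<open>I S\<close>
  and contracts to a subset of \<open>I\<close>, and it serves instead of \<open>I S\<close> because no sums of products have to
  be written down.\<close>

definition reynolds_ideal :: "'a mpoly set \<Rightarrow> 'a mpoly set" where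
  "reynolds_ideal I = {f \<in> S. \<forall>s\<in>S. reynolds (f * s) \<in> I}"

lemma reynolds_ideal_mult: "f \<in> reynolds_ideal I \<Longrightarrow> s \<in> S \<Longrightarrow> f * s \<in> reynolds_ideal I"
  by (simp add: reynolds_ideal_def poly_ring_mult mult.assoc)

lemma reynolds_ideal_add:
  assumes "ideal I R" "f \<in> reynolds_ideal I" "g \<in> reynolds_ideal I"
  shows "f + g \<in> reynolds_ideal I"
  using assms additive_subgroup.a_closed[OF ideal.axioms(1)[OF assms(1)]]
  by (simp add: reynolds_ideal_def poly_ring_add poly_ring_mult distrib_right reynolds_add)

lemma reynolds_ideal_zero:
  assumes "ideal I R"
  shows "0 \<in> reynolds_ideal I"
  using additive_subgroup.zero_closed[OF ideal.axioms(1)[OF assms]]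
  by (simp add: reynolds_ideal_def poly_ring_0 reynolds_zero)

lemma reynolds_ideal_sum:
  assumes "ideal I R" "\<And>y. y \<in> Y \<Longrightarrow> u y \<in> reynolds_ideal I"
  shows "sum u Y \<in> reynolds_ideal I"
  using assms(2)
  by (induction Y rule: infinite_finite_induct)
    (auto intro: reynolds_ideal_zero reynolds_ideal_add assms(1))

lemma reynolds_ideal_contract: "f \<in> reynolds_ideal I \<Longrightarrow> f \<in> carrier R \<Longrightarrow> f \<in> I"
  unfolding reynolds_ideal_def using reynolds_invariant[of f] poly_ring_1[of m] by force

lemma ideal_power_0: "ideal_power R I 0 = carrier R"
  and ideal_power_Suc: "ideal_power R I (Suc k) = ideal_prod R (ideal_power R I k) I"
  by (simp_all add: ideal_power_def ideals_set_def)

lemma ideal_power_ideal: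
  assumes "ideal I R"
  shows "ideal (ideal_power R I k) R"
proof -
  interpret R: cring R by (rule cring_R)
  show ?thesis
    by (induction k) (simp_all add: ideal_power_0 ideal_power_Suc R.oneideal
        R.ideal_prod_is_ideal assms)
qed

lemma reynolds_ideal_power_Suc:
  assumes "f \<in> reynolds_ideal (ideal_power R I k)" "r \<in> I" "ideal I R"
  shows "r * f \<in> reynolds_ideal (ideal_power R I (Suc k))"
proof -
  have r: "r \<in> carrier R"
    using assms(2,3) by (rule ideal.Icarr[rotated])
  have f: "f \<in> S"
    using assms(1) by (simp add: reynolds_ideal_def)
  have "reynolds (r * f * s) \<in> ideal_power R I (Suc k)" if s: "s \<in> S" for s
  proof -
    have "reynolds (r * f * s) = reynolds (f * s) \<otimes>\<^bsub>R\<^esub> r"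
      using reynolds_mult_invariant[OF r, of "f * s"] f s by (simp add: poly_ring_mult mult_ac)
    also have "\<dots> \<in> ideal_power R I (Suc k)"
      unfolding ideal_power_Suc
      using assms(1,2) s by (intro ideal_prod.prod) (simp_all add: reynolds_ideal_def)
    finally show ?thesis .
  qed
  then show ?thesis
    using f R_subset_S[OF r] by (simp add: reynolds_ideal_def poly_ring_mult)
qed

lemma reynolds_ideal_power_add:
  assumes "f \<in> reynolds_ideal (ideal_power R I k)" "r \<in> I" "ideal I R"
  shows "r ^ j * f \<in> reynolds_ideal (ideal_power R I (j + k))"
proof (induction j)
  case (Suc j)
  then show ?case
    using reynolds_ideal_power_Suc[OF Suc assms(2,3)] by (simp add: mult.assoc)
qed (use assms(1) in simp)

text \<open>Taking variables for the \<open>a\<^sub>g\<close> in \<open>prod_eq_sum_transfers\<close> shows that a product of as many variables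
  as \<open>G\<close> has elements is an \<open>S\<close>-linear combination of invariants of positive degree. Splitting off
  such a product from the monomial lowers \<open>k\<close> by one.\<close>

lemma noether_bound:
  assumes "ideal I R" and pos: "\<And>f d. f \<in> carrier R \<Longrightarrow> homogeneous d f \<Longrightarrow> d > 0 \<Longrightarrow> f \<in> I"
    and "keys t \<subseteq> {..<m}" "k * Coset.order G \<le> monom_deg t"
  shows "single t c \<in> reynolds_ideal (ideal_power R I k)"
  using assms(3,4)
proof (induction k arbitrary: t)
  case 0
  have "single t c \<in> S"
    using 0 by (simp add: poly_ring_single)
  then show ?case
    by (simp add: reynolds_ideal_def ideal_power_0 reynolds_closed poly_ring_mult)
next
  case (Suc k)
  then have "card (carrier G) \<le> monom_deg t"
    by (simp add: Coset.order_def)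
  then obtain v t' where t: "t = (\<Sum>g\<in>carrier G. single (v g) 1) + t'" "v ` carrier G \<subseteq> keys t"
    using monomial_split_variables[OF finite_group] by blast
  define a where "a = (\<lambda>g. single (single (v g) (1 :: nat)) (1 :: 'a))"
  have a: "a g \<in> S" "homogeneous 1 (a g)" if "g \<in> carrier G" for g
  proof -
    have "v g < m"
      using that t(2) Suc.prems(1) by blast
    then show "a g \<in> S" "homogeneous 1 (a g)"
      using homogeneous_single[of "single (v g) 1" "1 :: 'a"]
      by (simp_all add: a_def monom_deg_single poly_ring_single)
  qed
  have "single t c = (\<Prod>g\<in>carrier G. a g) * single t' c"
    by (simp add: t(1) a_def mult_single flip: single_sum_exponents[OF finite_group])
  also have "\<dots> = const_poly (order_inverse * of_nat (Coset.order G)) * ((\<Prod>g\<in>carrier G. a g) * single t' c)"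
    using order_inverse by (simp add: mult.commute const_poly_def)
  also have "\<dots> = const_poly order_inverse * single t' c * (of_nat (Coset.order G) * (\<Prod>g\<in>carrier G. a g))"
    by (simp add: const_poly_mult const_poly_of_nat mult_ac)
  also have "\<dots> = (\<Sum>Y\<in>Pow (carrier G) - {{}}. transfer (\<Prod>g\<in>Y. \<phi> g (a g)) *
      (single t' c * (const_poly order_inverse * (- 1) ^ Suc (card Y) * (\<Prod>g\<in>carrier G - Y. a g))))"
    by (subst prod_eq_sum_transfers[OF a(1)], assumption, subst sum_distrib_left, rule sum.cong)
      (simp_all add: mult_ac)
  also have "\<dots> \<in> reynolds_ideal (ideal_power R I (Suc k))"
  proof (rule reynolds_ideal_sum[OF ideal_power_ideal[OF assms(1)]])
    fix Y assume Y: "Y \<in> Pow (carrier G) - {{}}"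
    let ?b = "\<Prod>g\<in>Y. \<phi> g (a g)"
    have b: "?b \<in> S" "homogeneous (card Y) ?b"
      using Y a act_closed degree_preserving by (auto intro!: poly_ring_prod homogeneous_prod)
    have "homogeneous (card Y) (transfer ?b)"
      unfolding transfer_def using b degree_preserving by (auto intro: homogeneous_sum)
    moreover have "card Y > 0"
      using Y finite_subset[OF _ finite_group] by (auto simp: card_gt_0_iff)
    ultimately have "transfer ?b \<in> I"
      using pos transfer_closed[OF b(1)] by blast
    moreover have "single t' c \<in> reynolds_ideal (ideal_power R I k)"
    proof (rule Suc.IH)
      show "keys t' \<subseteq> {..<m}"
        using Suc.prems(1) t(1) by (simp add: keys_exponent_add)
      have "monom_deg (\<Sum>g\<in>Y. single (v g) 1) = card Y" if "finite Y" for Y :: "'g set"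
        using that by (induction Y rule: finite_induct)
          (simp_all add: monom_deg_add monom_deg_single monom_deg_eq_0_iff)
      then show "k * Coset.order G \<le> monom_deg t'"
        using Suc.prems(2) finite_group unfolding t(1) by (simp add: monom_deg_add Coset.order_def)
    qed
    moreover have "const_poly order_inverse * (- 1) ^ Suc (card Y) * (\<Prod>g\<in>carrier G - Y. a g) \<in> S"
      using a by (auto intro!: poly_ring_closed)
    ultimately show "transfer ?b * (single t' c * (const_poly order_inverse * (- 1) ^ Suc (card Y)
        * (\<Prod>g\<in>carrier G - Y. a g))) \<in> reynolds_ideal (ideal_power R I (Suc k))"
      by (intro reynolds_ideal_power_Suc reynolds_ideal_mult assms(1))
  qed
  finally show ?case .
qed

end

section \<open>Powers of the prime ideal, saturated in the polynomial ring\<close>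

locale invariants_at_prime = nonmodular_invariants G m \<phi> order_inverse
  for G (structure) and m :: nat and \<phi> :: "'g \<Rightarrow> 'a::idom mpoly \<Rightarrow> 'a mpoly" and order_inverse +
  fixes Q :: "'a mpoly set"
  assumes prime_Q: "primeideal Q R"
begin

sublocale Q: primeideal Q R
  by (rule prime_Q)

lemma Q_zero: "0 \<in> Q"
  using additive_subgroup.zero_closed[OF Q.additive_subgroup_axioms] unfolding R_simps .

lemma Q_add: "f \<in> Q \<Longrightarrow> g \<in> Q \<Longrightarrow> f + g \<in> Q"
  using additive_subgroup.a_closed[OF Q.additive_subgroup_axioms, of f g] unfolding R_simps .

lemma Q_mult: "f \<in> Q \<Longrightarrow> r \<in> carrier R \<Longrightarrow> r * f \<in> Q"
  using Q.I_l_closed[of f r] unfolding R_simps .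

lemma Q_subset_R: "q \<in> Q \<Longrightarrow> q \<in> carrier R"
  by (rule Q.Icarr)

text \<open>These are the elements \<open>f\<close> of \<open>S\<close> with \<open>t f \<in> Q\<^sup>k S\<close> for some \<open>t\<close> in \<open>R\<close> outside \<open>Q\<close>, in other words the
  contraction to \<open>S\<close> of the \<open>k\<close>-th power of \<open>Q\<close> extended to the localization of \<open>S\<close> at the complement
  of \<open>Q\<close> in \<open>R\<close>. Generating them by rules that include the cancellation of such \<open>t\<close> reduces the statements
  about Hasse derivatives and \<open>p\<close>-derivations to one check for each rule. A prime of \<open>S\<close> lying over \<open>Q\<close>
  is replaced by this set: it need not be chosen, and the Reynolds operator leads from it straight
  back to \<open>Q\<close>.\<close>

inductive saturated_power :: "nat \<Rightarrow> 'a mpoly \<Rightarrow> bool" where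
  base: "f \<in> S \<Longrightarrow> saturated_power 0 f"
| zero: "saturated_power k 0"
| add: "saturated_power k f \<Longrightarrow> saturated_power k g \<Longrightarrow> saturated_power k (f + g)"
| mult: "q \<in> Q \<Longrightarrow> saturated_power k f \<Longrightarrow> saturated_power (Suc k) (q * f)"
| cancel: "t \<in> carrier R \<Longrightarrow> t \<notin> Q \<Longrightarrow> f \<in> S \<Longrightarrow> saturated_power k (t * f) \<Longrightarrow> saturated_power k f"

lemma saturated_power_closed: "saturated_power k f \<Longrightarrow> f \<in> S"
  by (induction rule: saturated_power.induct)
    (auto intro: poly_ring_closed R_subset_S Q_subset_R)

lemma saturated_power_0_iff: "saturated_power 0 f \<longleftrightarrow> f \<in> S"
  using saturated_power_closed base by blast

lemma saturated_power_S_mult: "saturated_power k f \<Longrightarrow> s \<in> S \<Longrightarrow> saturated_power k (f * s)"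
proof (induction rule: saturated_power.induct)
  case (cancel t f k)
  then show ?case
    using saturated_power.cancel[of t "f * s" k] by (simp add: poly_ring_mult mult.assoc)
qed (auto simp: distrib_right mult.assoc intro: saturated_power.intros poly_ring_mult)

lemma saturated_power_pred: "saturated_power k f \<Longrightarrow> saturated_power (k - 1) f"
proof (induction rule: saturated_power.induct)
  case (mult q k f)
  then show ?case
    using saturated_power_S_mult[of k f q] Q_subset_R R_subset_S by (simp add: mult.commute)
qed (auto intro: saturated_power.intros)

lemma saturated_power_antimono: "saturated_power k f \<Longrightarrow> j \<le> k \<Longrightarrow> saturated_power j f"
proof (induction k)
  case (Suc k)
  then show ?case
    using saturated_power_pred[of "Suc k" f] by (cases "j = Suc k") auto
qed simp

lemma saturated_power_diff:
  assumes "saturated_power k f" "saturated_power k g"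
  shows "saturated_power k (f - g)"
proof -
  have "(- 1 :: 'a mpoly) \<in> S"
    using poly_ring_uminus[OF poly_ring_1] .
  then have "saturated_power k (- g)"
    using saturated_power_S_mult[OF assms(2)] by fastforce
  then show ?thesis
    using saturated_power.add[OF assms(1)] by fastforce
qed

lemma saturated_power_sum: "(\<And>y. y \<in> Y \<Longrightarrow> saturated_power k (u y)) \<Longrightarrow> saturated_power k (sum u Y)"
  by (induction Y rule: infinite_finite_induct) (auto intro: saturated_power.intros)

lemma ideal_power_imp_saturated_power: "f \<in> ideal_power R Q k \<Longrightarrow> saturated_power k f"
proof (induction k arbitrary: f)
  case 0
  then show ?case
    by (simp add: ideal_power_0 saturated_power_0_iff R_subset_S)
next
  case (Suc k)
  from Suc.prems show ?case
    unfolding ideal_power_Suc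
  proof (induction rule: ideal_prod.induct)
    case (prod i j)
    then show ?case
      using saturated_power.mult[OF prod(2) Suc.IH[OF prod(1)]] by (simp add: mult.commute)
  next
    case (sum f g)
    then show ?case
      by (simp add: saturated_power.add)
  qed
qed

lemma symbolic_power_imp_saturated_power:
  assumes "f \<in> symbolic_power R Q k"
  shows "saturated_power k f"
proof -
  interpret loc: prime_localization Q R
    by (rule prime_localization.intro[OF prime_Q])
  obtain t where t: "t \<in> carrier R - Q" "t * f \<in> ideal_power R Q k"
    using loc.symbolic_powerD[OF assms] by auto
  have "f \<in> S"
    using assms R_subset_S by (simp add: symbolic_power_def)
  then show ?thesis
    using saturated_power.cancel[of t f k] t ideal_power_imp_saturated_power by blast
qed

lemma reynolds_saturated_power: "saturated_power k f \<Longrightarrow> k > 0 \<Longrightarrow> reynolds f \<in> Q"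
proof (induction rule: saturated_power.induct)
  case (zero k)
  show ?case
    by (simp add: reynolds_zero Q_zero)
next
  case (add k f g)
  then show ?case
    by (simp add: reynolds_add saturated_power_closed Q_add)
next
  case (mult q k f)
  then show ?case
    using Q_mult[of q "reynolds f"]
    by (simp add: reynolds_mult_invariant Q_subset_R saturated_power_closed reynolds_closed
        mult.commute[of q "reynolds f"])
next
  case (cancel t f k)
  then show ?case
    using Q.I_prime[of t "reynolds f"] by (simp add: reynolds_mult_invariant reynolds_closed)
qed simp

text \<open>In the Leibniz expansion of \<open>q f\<close> only one term does not differentiate \<open>q\<close>, and it keeps the factor \<open>q\<close>;
  all others take a derivative of \<open>f\<close> of order at most \<open>j - 1\<close>. For the cancellation of \<open>t\<close> the same
  expansion of \<open>t f\<close> is solved for \<open>t\<close> times the derivative of \<open>f\<close> of order \<open>j\<close>, the remaining terms being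
  covered by induction on \<open>j\<close>.\<close>

lemma hasse_saturated_power: "saturated_power k f \<Longrightarrow> saturated_power (k - j) (hasse i j f)"
proof (induction arbitrary: j rule: saturated_power.induct)
  case (base f)
  then show ?case
    by (simp add: saturated_power_0_iff hasse_closed)
next
  case (zero k)
  then show ?case
    by (simp add: hasse_zero saturated_power.zero)
next
  case (add k f g)
  then show ?case
    by (simp add: hasse_add saturated_power.add)
next
  case (mult q k f)
  have q: "q \<in> S"
    using mult.hyps(1) by (intro R_subset_S Q_subset_R)
  have "saturated_power (Suc k - j) (hasse i l q * hasse i (j - l) f)" if "l \<le> j" for l
  proof (cases "l = 0")
    case True
    have "saturated_power (Suc (k - j)) (q * hasse i j f)"
      by (rule saturated_power.mult[OF mult.hyps(1) mult.IH])
    then show ?thesis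
      using True saturated_power_antimono by (simp add: hasse_0)
  next
    case False
    then have "saturated_power (Suc k - j) (hasse i (j - l) f)"
      using saturated_power_antimono[OF mult.IH[of "j - l"]] that by simp
    then show ?thesis
      using saturated_power_S_mult hasse_closed[OF q] by (metis mult.commute)
  qed
  then show ?case
    unfolding hasse_mult by (intro saturated_power_sum) simp
next
  case (cancel t f k)
  have t: "t \<in> S"
    using cancel.hyps(1) by (rule R_subset_S)
  show ?case
  proof (induction j rule: less_induct)
    case (less j)
    have "saturated_power (k - j) (hasse i l t * hasse i (j - l) f)" if "l \<in> {1..j}" for l
    proof -
      have "saturated_power (k - (j - l)) (hasse i (j - l) f)"
        using that by (intro less.IH) simp
      then have "saturated_power (k - j) (hasse i (j - l) f)"
        using saturated_power_antimono by simp
      then show ?thesis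
        using saturated_power_S_mult hasse_closed[OF t] by (metis mult.commute)
    qed
    then have "saturated_power (k - j) (hasse i j (t * f) - (\<Sum>l\<in>{1..j}. hasse i l t * hasse i (j - l) f))"
      by (intro saturated_power_diff saturated_power_sum cancel.IH)
    moreover have "{..j} = insert 0 {1..j}"
      by auto
    ultimately have "saturated_power (k - j) (t * hasse i j f)"
      by (simp add: hasse_mult hasse_0)
    then show ?case
      using saturated_power.cancel[OF cancel.hyps(1,2) hasse_closed[OF cancel.hyps(3)]] by blast
  qed
qed

text \<open>Hasse derivatives are applied for one variable of \<open>a\<close> after the other. On exponents \<open>t\<close> that do not
  involve the variable, such a derivative only shifts the exponent, as its binomial coefficient is \<open>1\<close>. The
  restriction on \<open>t\<close> makes the induction work; afterwards only \<open>t = 0\<close> is of interest.\<close>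

lemma coefficient_becomes_constant_coeff:
  assumes "saturated_power k f"
  shows "\<exists>g. saturated_power (k - monom_deg a) g \<and> (\<forall>t. keys t \<inter> keys a = {} \<longrightarrow> lookup g t = lookup f (t + a))"
  using assms
proof (induction "card (keys a)" arbitrary: a k f)
  case 0
  then have "a = 0"
    by (metis card_0_eq finite_keys keys_eq_empty)
  then show ?case
    using 0 monom_deg_eq_0_iff[of a] by auto
next
  case (Suc n)
  then obtain i where i: "i \<in> keys a"
    by (metis card.empty all_not_in_conv nat.distinct(1))
  define e where "e = lookup a i"
  define b where "b = a - single i e"
  have a: "a = b + single i e"
    by (rule poly_mapping_eqI)
      (auto simp: b_def e_def lookup_add lookup_minus lookup_single when_def)
  have keys_b: "keys b = keys a - {i}"
    by (auto simp: b_def e_def in_keys_iff lookup_minus lookup_single when_def split: if_splits)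
  then have "n = card (keys b)"
    using Suc.hyps(2) i by simp
  then obtain g where g: "saturated_power (k - e - monom_deg b) g"
    "\<And>t. keys t \<inter> keys b = {} \<Longrightarrow> lookup g t = lookup (hasse i e f) (t + b)"
    using Suc.hyps(1)[of b "k - e" "hasse i e f"] hasse_saturated_power[OF Suc.prems] by blast
  have "lookup g t = lookup f (t + a)" if t: "keys t \<inter> keys a = {}" for t
  proof -
    have "lookup t i = 0" "lookup b i = 0"
      using t i keys_b by (auto simp: in_keys_iff)
    moreover have "keys t \<inter> keys b = {}"
      using t keys_b by blast
    ultimately show ?thesis
      using g(2) by (simp add: lookup_hasse lookup_add a add.assoc)
  qed
  moreover have "k - monom_deg a = k - e - monom_deg b"
    by (simp add: a monom_deg_add monom_deg_single)
  ultimately show ?case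
    using g(1) by metis
qed

text \<open>In the product rule every term contains a \<open>p\<close>-th power of one factor or the number \<open>p\<close>. A \<open>p\<close>-th
  power has at least the order of its base, and the factor \<open>p \<in> Q\<close> makes up for the order that \<open>\<Delta>\<close> loses.\<close>

lemma p_derivation_saturated_power:
  assumes "Factorial_Ring.prime p" "p_derivation (poly_ring m) p \<Delta>" "of_nat p \<in> Q"
  shows "saturated_power k f \<Longrightarrow> saturated_power (k - 1) (\<Delta> f)"
proof (induction rule: saturated_power.induct)
  have \<Delta>: "\<Delta> f \<in> S" if "f \<in> S" for f
    using assms(2) that unfolding p_derivation_poly_ring_iff by blast
  have p: "p > 0"
    using assms(1) prime_gt_0_nat by blast
  have power: "saturated_power k (f ^ p * s)" if "saturated_power k f" "s \<in> S" for f s k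
  proof -
    have "f ^ (p - 1) * s \<in> S"
      using that saturated_power_closed by (blast intro: poly_ring_closed)
    then have "saturated_power k (f * (f ^ (p - 1) * s))"
      by (rule saturated_power_S_mult[OF that(1)])
    then show ?thesis
      using p by (simp add: power_eq_if mult.assoc)
  qed
  {
    case (base f)
    then show ?case
      by (simp add: saturated_power_0_iff \<Delta>)
  next
    case (zero k)
    have "\<Delta> 0 = 0"
      using p_derivation_poly_add[OF assms(1,2) poly_ring_0 poly_ring_0]
      by (metis add.right_neutral add_cancel_right_right mult_zero_left)
    then show ?case
      by (simp add: saturated_power.zero)
  next
    case (add k f g)
    then obtain h where h: "h \<in> S" "\<Delta> (f + g) = \<Delta> f + \<Delta> g + f * h"
      using p_derivation_poly_add[OF assms(1,2)] saturated_power_closed by metis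
    then show ?case
      using add saturated_power_pred saturated_power_S_mult by (auto intro: saturated_power.add)
  next
    case (mult q k f)
    have f: "f \<in> S" and q: "q \<in> S"
      using mult.hyps by (auto intro: saturated_power_closed R_subset_S Q_subset_R)
    have Q_mult: "saturated_power k (r * \<Delta> f)" if "r \<in> Q" for r
    proof (cases k)
      case 0
      then show ?thesis
        using f that by (auto simp: saturated_power_0_iff intro: poly_ring_mult \<Delta> R_subset_S Q_subset_R)
    next
      case (Suc l)
      then show ?thesis
        using saturated_power.mult[OF that mult.IH] by simp
    qed
    have "saturated_power k (q ^ p * \<Delta> f)"
      using saturated_power_S_mult[OF Q_mult[OF mult.hyps(1)] poly_ring_power[OF q, of "p - 1"]] p
      by (simp add: power_eq_if mult_ac)
    moreover have "saturated_power k (f ^ p * \<Delta> q)"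
      by (rule power[OF mult.hyps(2) \<Delta>[OF q]])
    moreover have "saturated_power k (of_nat p * \<Delta> q * \<Delta> f)"
      using saturated_power_S_mult[OF Q_mult[OF assms(3)] \<Delta>[OF q]] by (simp add: mult_ac)
    ultimately show ?case
      unfolding p_derivation_poly_mult[OF assms(2) q f] by (auto intro: saturated_power.add)
  next
    case (cancel t f k)
    have t: "t \<in> S"
      using cancel.hyps(1) by (rule R_subset_S)
    have t_power: "t ^ p \<in> carrier R" "t ^ p \<notin> Q"
    proof -
      have "t ^ l \<notin> Q" for l
      proof (induction l)
        case 0
        have "Q \<noteq> carrier R"
          using Q.I_notcarr by blast
        then show ?case
          using Q.one_imp_carrier by auto
      next
        case (Suc l)
        then show ?case
          using Q.I_prime[of t "t ^ l"] cancel.hyps(1,2) R_power by auto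
      qed
      then show "t ^ p \<in> carrier R" "t ^ p \<notin> Q"
        using cancel.hyps(1) R_power by auto
    qed
    have f: "saturated_power k f"
      using cancel.hyps by (rule saturated_power.cancel)
    \<comment> \<open>The term \<open>p \<Delta>(f) \<Delta>(t)\<close> of \<open>\<Delta>(t f)\<close> again contains the element \<open>\<Delta>(f)\<close> in question, but with the
      factor \<open>p \<in> Q\<close>, so that its order can be raised one step at a time.\<close>
    have "saturated_power l (\<Delta> f)" if "l \<le> k - 1" for l
      using that
    proof (induction l)
      case 0
      then show ?case
        using \<Delta>[OF cancel.hyps(3)] by (simp add: saturated_power_0_iff)
    next
      case (Suc l)
      then have "saturated_power (Suc l) (of_nat p * \<Delta> f)"
        by (intro saturated_power.mult assms(3)) simp
      then have "saturated_power (Suc l) (of_nat p * \<Delta> f * \<Delta> t)"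
        by (rule saturated_power_S_mult[OF _ \<Delta>[OF t]])
      moreover have "saturated_power (Suc l) (f ^ p * \<Delta> t)"
        by (rule power[OF saturated_power_antimono[OF f] \<Delta>[OF t]]) (use Suc.prems in simp)
      moreover have "saturated_power (Suc l) (\<Delta> (t * f))"
        by (rule saturated_power_antimono[OF cancel.IH Suc.prems])
      ultimately have "saturated_power (Suc l) (\<Delta> (t * f) - f ^ p * \<Delta> t - of_nat p * \<Delta> f * \<Delta> t)"
        by (intro saturated_power_diff)
      then have "saturated_power (Suc l) (t ^ p * \<Delta> f)"
        unfolding p_derivation_poly_mult[OF assms(2) t cancel.hyps(3)] by (simp add: mult_ac)
      then show ?case
        by (rule saturated_power.cancel[OF t_power \<Delta>[OF cancel.hyps(3)]])
    qed
    then show ?case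
      by simp
  }
qed

definition const_ideal :: "'a set" where
  "const_ideal = {c. const_poly c \<in> Q}"

lemma const_ideal_prime: "primeideal const_ideal (ring_of_type_algebra :: 'a ring)"
proof (rule primeidealI)
  interpret A: cring "ring_of_type_algebra :: 'a ring"
    by (rule cring_from_type_algebra)
  show "cring (ring_of_type_algebra :: 'a ring)" ..
  show "ideal const_ideal (ring_of_type_algebra :: 'a ring)"
  proof (rule idealI[OF A.ring_axioms])
    show "subgroup const_ideal (add_monoid (ring_of_type_algebra :: 'a ring))"
    proof (rule A.add.subgroupI)
      show "const_ideal \<noteq> {}"
        using Q_zero by (auto simp: const_ideal_def const_poly_def intro: exI[of _ 0])
      show "\<ominus>\<^bsub>ring_of_type_algebra\<^esub> c \<in> const_ideal" if "c \<in> const_ideal" for c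
      proof -
        have "\<ominus>\<^bsub>ring_of_type_algebra\<^esub> c = - 1 * c"
          using A.minus_equality[of "- c" c] by (simp add: ring_of_type_algebra_def)
        then show ?thesis
          using that Q_mult[OF _ R_const] by (simp only: const_ideal_def mem_Collect_eq const_poly_mult)
      qed
    qed (use Q_add in \<open>simp_all add: ring_of_type_algebra_def const_ideal_def const_poly_def single_add\<close>)
  qed (use Q_mult[OF _ R_const] in \<open>auto simp: ring_of_type_algebra_def const_ideal_def const_poly_mult mult.commute\<close>)
  have "1 \<notin> const_ideal"
    using Q.I_notcarr Q.one_imp_carrier by (auto simp: const_ideal_def const_poly_def)
  then show "carrier (ring_of_type_algebra :: 'a ring) \<noteq> const_ideal"
    by (auto simp: ring_of_type_algebra_def)
  show "a \<in> const_ideal \<or> b \<in> const_ideal"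
    if "a \<otimes>\<^bsub>ring_of_type_algebra\<^esub> b \<in> const_ideal" for a b
    using Q.I_prime[of "const_poly a" "const_poly b"] that R_const
    by (simp add: ring_of_type_algebra_def const_ideal_def const_poly_mult)
qed

text \<open>It suffices to look at homogeneous generators, since taking the constant term is a ring homomorphism:
  such a generator is a constant or has constant term zero.\<close>

lemma const_coeff_in_const_ideal:
  assumes "homogeneous_ideal R Q" "q \<in> Q"
  shows "lookup q 0 \<in> const_ideal"
proof -
  obtain H where H: "H \<subseteq> carrier R" "\<And>h. h \<in> H \<Longrightarrow> \<exists>d. homogeneous d h" "Q = Idl\<^bsub>R\<^esub> H"
    using assms(1) unfolding homogeneous_ideal_def by blast
  let ?I = "{f \<in> carrier R. const_poly (lookup f 0) \<in> Q}"
  have mult: "r * f \<in> ?I" if "f \<in> ?I" "r \<in> carrier R" for r f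
    using that Q_mult[OF _ R_const] by (simp add: R_mult const_coeff_mult const_poly_mult)
  have ideal: "ideal ?I R"
  proof (rule idealI[OF Q.ring_axioms])
    show "subgroup ?I (add_monoid R)"
    proof (rule Q.add.subgroupI)
      show "?I \<noteq> {}"
        using Q_zero R_zero by (force simp: const_poly_def)
      show "\<ominus>\<^bsub>R\<^esub> f \<in> ?I" if "f \<in> ?I" for f
      proof -
        have "\<ominus>\<^bsub>R\<^esub> f = const_poly (- 1) * f"
          using Q.minus_equality[of "- f" f] that R_uminus[of f]
          by (simp add: const_poly_def single_uminus)
        then show ?thesis
          using mult[OF that R_const] by simp
      qed
      show "f \<oplus>\<^bsub>R\<^esub> g \<in> ?I" if "f \<in> ?I" "g \<in> ?I" for f g
        using that Q_add[of "const_poly (lookup f 0)" "const_poly (lookup g 0)"]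
        by (simp add: R_add lookup_add const_poly_def single_add)
    qed blast
    show "r \<otimes>\<^bsub>R\<^esub> f \<in> ?I" if "f \<in> ?I" "r \<in> carrier R" for r f
      using mult[OF that] by simp
    show "f \<otimes>\<^bsub>R\<^esub> r \<in> ?I" if "f \<in> ?I" "r \<in> carrier R" for r f
      using mult[OF that] by (simp add: mult.commute)
  qed
  have "H \<subseteq> ?I"
  proof
    fix h assume h: "h \<in> H"
    then obtain d where d: "homogeneous d h"
      using H(2) by blast
    have "h \<in> Q"
      using h H Q.genideal_self by blast
    have "const_poly (lookup h 0) \<in> Q"
    proof (cases "d = 0")
      case True
      then have "t = 0" if "t \<in> keys h" for t
        using that d by (simp add: homogeneous_def monom_deg_eq_0_iff)
      then have "h = const_poly (lookup h 0)"
        by (intro poly_mapping_eqI) (auto simp: const_poly_def lookup_single when_def in_keys_iff)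
      then show ?thesis
        using \<open>h \<in> Q\<close> by simp
    next
      case False
      then show ?thesis
        using const_coeff_homogeneous[OF d] Q_zero by (simp add: const_poly_def)
    qed
    then show "h \<in> ?I"
      using h H(1) by blast
  qed
  then have "Idl\<^bsub>R\<^esub> H \<subseteq> ?I"
    by (rule Q.genideal_minimal[OF ideal])
  then have "const_poly (lookup q 0) \<in> Q"
    using assms(2) unfolding H(3) by blast
  then show ?thesis
    by (simp add: const_ideal_def)
qed

lemma saturated_power_const_coeff:
  assumes "homogeneous_ideal R Q" "saturated_power k f" "k > 0"
  shows "lookup f 0 \<in> const_ideal"
  using const_coeff_in_const_ideal[OF assms(1) reynolds_saturated_power[OF assms(2,3)]]
    const_coeff_reynolds[OF saturated_power_closed[OF assms(2)]] by simp

text \<open>If \<open>p\<close> is not in \<open>Q\<close>, then constant terms of elements of \<open>J\<^sub>k\<close> with \<open>k > 0\<close> vanish. If it is, then by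
  induction on \<open>l\<close> the constant term \<open>c\<close> of an element of \<open>J\<^sub>l\<^sub>+\<^sub>1\<close> and the constant term \<open>\<delta>(c)\<close> of its
  image under the extended \<open>p\<close>-derivation are both divisible by \<open>p\<^sup>l\<close>; as \<open>\<delta>\<close> lowers positive
  valuations by one, \<open>c\<close> cannot have valuation exactly \<open>l\<close>, and for \<open>l = 0\<close> it is a multiple of \<open>p\<close>
  by membership in the prime ideal of constant terms.\<close>

lemma saturated_power_coeff_divisible:
  fixes \<delta> :: "'a \<Rightarrow> 'a"
  assumes p: "Factorial_Ring.prime p"
    and dvr: "discrete_valuation_ring (ring_of_type_algebra :: 'a ring)"
    and unif: "uniformizer (ring_of_type_algebra :: 'a ring)
      (add_pow (ring_of_type_algebra :: 'a ring) p \<one>\<^bsub>ring_of_type_algebra\<^esub>)"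
    and \<delta>: "p_derivation ring_of_type_algebra p \<delta>"
    and hom: "homogeneous_ideal R Q" and f: "saturated_power k f"
  shows "of_nat p ^ (k - monom_deg a) dvd lookup f a"
proof -
  obtain \<Delta> where \<Delta>: "p_derivation (poly_ring m) p \<Delta>"
    "\<And>g. g \<in> S \<Longrightarrow> lookup (\<Delta> g) 0 = \<delta> (lookup g 0)"
    using p_derivation_extends_to_polynomials[OF p \<delta>] by blast
  have const_divisible: "of_nat p ^ l dvd lookup g 0" if "saturated_power l g" for l g
    using that
  proof (induction l arbitrary: g)
    case (Suc l)
    have c: "lookup g 0 \<in> const_ideal"
      using saturated_power_const_coeff[OF hom Suc.prems] by simp
    consider "const_ideal = {0}" | "const_ideal = {c. of_nat p dvd c}"
      using prime_ideal_type[OF dvr unif const_ideal_prime] by blast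
    then show ?case
    proof cases
      case 1
      then show ?thesis
        using c by simp
    next
      case 2
      then have "of_nat p \<in> const_ideal"
        by simp
      then have "of_nat p \<in> Q"
        by (simp add: const_ideal_def const_poly_of_nat)
      then have "saturated_power l (\<Delta> g)"
        using p_derivation_saturated_power[OF p \<Delta>(1) _ Suc.prems] by simp
      then have \<Delta>g: "of_nat p ^ l dvd \<delta> (lookup g 0)"
        using Suc.IH \<Delta>(2)[OF saturated_power_closed[OF Suc.prems]] by metis
      have IH: "of_nat p ^ l dvd lookup g 0"
        using Suc.IH saturated_power_pred[OF Suc.prems] by simp
      show ?thesis
      proof (rule ccontr)
        assume not_dvd: "\<not> of_nat p ^ Suc l dvd lookup g 0"
        obtain j where j: "l = Suc j"
          using not_dvd c 2 by (cases l) auto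
        show False
          using p_derivation_lowers_valuation[OF dvr unif \<delta> prime_gt_1_nat[OF p]] IH not_dvd \<Delta>g
          unfolding j by blast
      qed
    qed
  qed simp
  obtain g where g: "saturated_power (k - monom_deg a) g"
    "\<And>t. keys t \<inter> keys a = {} \<Longrightarrow> lookup g t = lookup f (t + a)"
    using coefficient_becomes_constant_coeff[OF f, of a] by blast
  show ?thesis
    using const_divisible[OF g(1)] g(2)[of 0] by simp
qed

end

theorem theorem2:
  fixes p m n :: nat
    and A :: "'a::idom ring"
    and G :: "('g, 'c) monoid_scheme"
    and \<phi> :: "'g \<Rightarrow> 'a mpoly \<Rightarrow> 'a mpoly"
    and R :: "'a mpoly ring"
    and Q \<mm> :: "'a mpoly set"
  defines "A \<equiv> ring_of_type_algebra"
    and "R \<equiv> invariant_ring G m \<phi>"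
    and "\<mm> \<equiv> positive_part R <+>\<^bsub>R\<^esub> PIdl\<^bsub>R\<^esub> (add_pow R p \<one>\<^bsub>R\<^esub>)"
  assumes "Factorial_Ring.prime p"
    and "discrete_valuation_ring A"
    and "uniformizer A (add_pow A p \<one>\<^bsub>A\<^esub>)"
    and "perfect_field (A Quot (PIdl\<^bsub>A\<^esub> (add_pow A p \<one>\<^bsub>A\<^esub>)))"
    and "\<exists>\<delta>. p_derivation A p \<delta>"
    and "group G" and "finite (carrier G)" and "coprime (Coset.order G) p"
    and "graded_algebra_action G m \<phi>"
    and "primeideal Q R" and "homogeneous_ideal R Q"
    and "n \<ge> 1"
  shows "symbolic_power R Q (n * Coset.order G) \<subseteq> ideal_power R \<mm> n"
proof
  let ?D = "Coset.order G"
  fix f assume f: "f \<in> symbolic_power R Q (n * ?D)"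
  obtain e :: 'a where e: "of_nat ?D * e = 1"
    using of_nat_invertible[OF assms(5,6)[unfolded A_def] assms(11)] by blast
  obtain \<delta> :: "'a \<Rightarrow> 'a" where \<delta>: "p_derivation ring_of_type_algebra p \<delta>"
    using assms(8) unfolding A_def by blast
  interpret invariants_at_prime G m \<phi> e Q
    by (intro invariants_at_prime.intro nonmodular_invariants.intro
        nonmodular_invariants_axioms.intro invariants_at_prime_axioms.intro
        assms(10,12) e assms(13)[unfolded R_def])
  have D: "?D \<ge> 1"
    using e by (cases "?D") auto
  have pos_ideal: "ideal (positive_part R) R"
    unfolding positive_part_def R_def by (rule Q.genideal_ideal) blast
  have p_eq: "add_pow R p \<one>\<^bsub>R\<^esub> = of_nat p"
    using add_pow_one_poly_ring[of m p]
    by (simp add: R_def add_pow_def invariant_ring_def nat_pow_def)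
  have p_R: "of_nat p \<in> carrier R"
    using R_const[of "of_nat p"] by (simp add: R_def const_poly_of_nat)
  then have p_ideal: "ideal (PIdl\<^bsub>R\<^esub> (of_nat p)) R"
    unfolding R_def by (rule Q.cgenideal_ideal)
  have mm: "\<mm> = positive_part R <+>\<^bsub>R\<^esub> PIdl\<^bsub>R\<^esub> (of_nat p)"
    by (simp add: \<mm>_def p_eq)
  have mm_ideal: "ideal \<mm> R"
    unfolding mm using pos_ideal p_ideal unfolding R_def by (rule Q.add_ideals)
  have "positive_part R \<union> PIdl\<^bsub>R\<^esub> (of_nat p) \<subseteq> carrier R"
    using ideal.Icarr[OF pos_ideal] ideal.Icarr[OF p_ideal] by blast
  then have union_mm: "positive_part R \<union> PIdl\<^bsub>R\<^esub> (of_nat p) \<subseteq> \<mm>"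
    using Q.genideal_self Q.union_genideal pos_ideal p_ideal unfolding mm R_def by metis
  have p_mm: "of_nat p \<in> \<mm>"
    using union_mm p_R Q.cgenideal_self unfolding R_def by blast
  have pos_mm: "g \<in> \<mm>" if "g \<in> carrier R" "homogeneous d g" "d > 0" for g d
  proof -
    have "{g \<in> carrier R. \<exists>d>0. homogeneous d g} \<subseteq> positive_part R"
      unfolding positive_part_def R_def by (rule Q.genideal_self) blast
    then show ?thesis
      using that union_mm by blast
  qed
  have fR: "f \<in> carrier R"
    using f by (simp add: symbolic_power_def)
  have ext: "saturated_power (n * ?D) f"
    using symbolic_power_imp_saturated_power f by (simp add: R_def)
  have monomial: "single t (lookup f t) \<in> reynolds_ideal (ideal_power R \<mm> n)"
    if t: "t \<in> keys f" for t
  proof -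
    \<comment> \<open>A term of \<open>f\<close> with coefficient divisible by \<open>p\<^sup>j\<close> needs only \<open>n - j\<close> further factors from \<open>R\<^sub>>\<^sub>0\<close>,
      for which degree \<open>(n - j) D\<close> is enough.\<close>
    define j where "j = min n (n * ?D - monom_deg t)"
    have t_vars: "keys t \<subseteq> {..<m}"
      using t R_subset_S fR unfolding R_def mem_poly_ring by blast
    have "(of_nat p :: 'a) ^ j dvd of_nat p ^ (n * ?D - monom_deg t)"
      by (rule le_imp_power_dvd) (simp add: j_def)
    also have "\<dots> dvd lookup f t"
      using saturated_power_coeff_divisible[OF assms(4) assms(5,6)[unfolded A_def] \<delta> _ ext] assms(14)
      by (simp add: R_def)
    finally obtain c where c: "lookup f t = of_nat p ^ j * c" ..
    have "(n - j) * ?D \<le> monom_deg t"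
    proof (cases "j = n")
      case False
      then have j: "j = n * ?D - monom_deg t" "j < n"
        by (auto simp: j_def min_def split: if_splits)
      have "j * 1 \<le> j * ?D"
        using D by (rule mult_le_mono2)
      then show ?thesis
        using j by (simp add: diff_mult_distrib)
    qed simp
    then have "single t c \<in> reynolds_ideal (ideal_power R \<mm> (n - j))"
      using noether_bound[of \<mm>] mm_ideal pos_mm t_vars unfolding R_def by blast
    then have "of_nat p ^ j * single t c \<in> reynolds_ideal (ideal_power R \<mm> (j + (n - j)))"
      using reynolds_ideal_power_add p_mm mm_ideal unfolding R_def by blast
    moreover have "of_nat p ^ j * single t c = single t (lookup f t)"
    proof -
      have "(of_nat p ^ j :: 'a mpoly) = const_poly (of_nat p ^ j)"
        by (metis const_poly_of_nat of_nat_power)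
      then show ?thesis
        by (simp add: c const_poly_def mult_single)
    qed
    moreover have "j + (n - j) = n"
      by (simp add: j_def)
    ultimately show ?thesis
      by simp
  qed
  have "(\<Sum>t\<in>keys f. single t (lookup f t)) \<in> reynolds_ideal (ideal_power R \<mm> n)"
    using mm_ideal monomial unfolding R_def
    by (intro reynolds_ideal_sum ideal_power_ideal) simp_all
  then show "f \<in> ideal_power R \<mm> n"
    using reynolds_ideal_contract fR poly_eq_sum_monomials[of f] by (simp add: R_def)
qed

end
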